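(* Let $X$ and $Y$ be connected topological manifolds of equal dimensions with nonempty boundaries, with $X$ compact. Let $f\colon X\to Y$ be a continuous mapping that injectively maps $\partial X$ to $\partial Y$ (that is, $f(\partial X)\subseteq\partial Y$ and $f|_{\partial X}$ is injective), and such that $f|_{X\setminus\partial X}$ is an immersion. Then $f$ is a homeomorphism of $X$ onto $Y$.
   Context: An $n$-dimensional topological manifold is a Hausdorff topological space having a countable cover by open sets each of which is homeomorphic either to $\mathbb{R}^n$ or to the half-space $\mathbb{R}^n_+=\{(x_1,\ldots,x_n) : x_i\in\mathbb{R},\ x_1\ge 0\}$. Points having a neighborhood homeomorphic to $\mathbb{R}^n$ are interior points; the boundary $\partial X$ is the subspace of points that are not interior. A continuous mapping $g\colon A\to B$ of topological spaces is called an immersion if every point $a\in A$ has a neighborhood $U$ in $A$ such that $g|_U$ is a homeomorphism of $U$ onto $g(U)$. *)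

theory Defs
  imports "HOL-Analysis.Analysis"
begin

(* Euclidean_space indexes coordinates from 0, so x 0 is the first coordinate.  For n = 0 the
   half-space is the one-point space, just like Euclidean_space 0. *)
definition Euclidean_half_space :: "nat \<Rightarrow> (nat \<Rightarrow> real) topology" where
  "Euclidean_half_space n = subtopology (Euclidean_space n) {x. x 0 \<ge> 0}"

definition topological_manifold :: "nat \<Rightarrow> 'a topology \<Rightarrow> bool" where
  "topological_manifold n X \<longleftrightarrow>
     Hausdorff_space X \<and>
     (\<exists>\<U>. countable \<U> \<and> \<Union>\<U> = topspace X \<and>
        (\<forall>U\<in>\<U>. openin X U \<and>
           (subtopology X U homeomorphic_space Euclidean_space n \<or>
            subtopology X U homeomorphic_space Euclidean_half_space n)))"

(* Neighborhoods are open throughout. *)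
definition manifold_interior :: "nat \<Rightarrow> 'a topology \<Rightarrow> 'a set" where
  "manifold_interior n X =
     {x. \<exists>U. openin X U \<and> x \<in> U \<and> subtopology X U homeomorphic_space Euclidean_space n}"

definition manifold_boundary :: "nat \<Rightarrow> 'a topology \<Rightarrow> 'a set" where
  "manifold_boundary n X = topspace X - manifold_interior n X"

(* A topological immersion; no differentiability is involved. *)
definition immersion_map :: "'a topology \<Rightarrow> 'b topology \<Rightarrow> ('a \<Rightarrow> 'b) \<Rightarrow> bool" where
  "immersion_map A B g \<longleftrightarrow>
     continuous_map A B g \<and>
     (\<forall>a\<in>topspace A. \<exists>U. openin A U \<and> a \<in> U \<and>
        homeomorphic_map (subtopology A U) (subtopology B (g ` U)) g)"

end

theory Submission
  imports Defs "HOL-Homology.Invariance_of_Domain"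
begin

text \<open>Invariance of domain makes every injective continuous map from an open subset of
\<open>\<real>\<^sup>n\<close> to an \<open>n\<close>-manifold open, with image in the interior (\<open>invariance_of_domain_manifold\<close>).
So \<open>f\<close> sends interior points to interior points and is an open local homeomorphism there; as it
also sends boundary to boundary, the preimage of \<open>int Y\<close> is exactly \<open>int X\<close>. Since \<open>X\<close> is
compact, \<open>f\<close> restricts to a proper local homeomorphism \<open>int X \<rightarrow> int Y\<close>, morally a finite covering
of the connected space \<open>int Y\<close>. The point is to see that it has one sheet.

Take \<open>p\<close> in the boundary of \<open>X\<close>. Injectivity on the boundary gives \<open>f\<^sup>-\<^sup>1(f p) = {p}\<close>, so by
compactness the whole fibre over a point near \<open>f p\<close> lies in a small half-ball around \<open>p\<close>, whose
interior part is convex in a chart. Two points \<open>e1\<close>, \<open>e2\<close> of one such fibre over an interior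
point are joined by a segment there. The image of the segment is a loop in an open half-space
chart of \<open>Y\<close>, and, being compact, it stays in a closed box of that half-space. A box is simply
connected, so the covering is trivial over it: the inverse chart on the box lifts through \<open>f\<close>
(\<open>liftable_box\<close>). Following the lift that starts at \<open>e1\<close> around the loop one comes back
to \<open>e1\<close>; but by uniqueness of lifts one has followed the segment, which ends at \<open>e2\<close>. So
\<open>e1 = e2\<close> (\<open>injective_near_boundary_point\<close>).

Instead of counting sheets, both "at most one preimage" and "at least two preimages" are seen to
be open conditions over \<open>int Y\<close>, so injectivity near \<open>f p\<close> spreads over \<open>int Y\<close>
(\<open>injective_over_connected\<close>); likewise the image of \<open>f\<close> is open and closed over \<open>int Y\<close>
(\<open>image_contains_connected\<close>). As \<open>int Y\<close> is dense and the image is closed, \<open>f\<close> is onto. A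
continuous bijection from a compact space to a Hausdorff space is a homeomorphism.\<close>

section \<open>Convex sets and boxes in Euclidean space\<close>

lemma coordinate_continuous_Euclidean_space:
  "continuous_map (subtopology (Euclidean_space n) S) euclideanreal (\<lambda>x. x i)"
  unfolding Euclidean_space_def
  by (intro continuous_map_from_subtopology continuous_map_product_projection) auto

lemma segment_continuous_Euclidean_space:
  assumes "x \<in> topspace (Euclidean_space n)" "y \<in> topspace (Euclidean_space n)"
  shows "continuous_map euclideanreal (Euclidean_space n) (\<lambda>t i. (1 - t) * x i + t * y i)"
  using assms
  unfolding Euclidean_space_def continuous_map_in_subtopology
  by (auto simp: continuous_map_componentwise_UNIV intro!: continuous_intros)

lemma connectedin_Euclidean_space_convex:
  assumes "S \<subseteq> topspace (Euclidean_space n)"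
    and "\<And>x y t. x \<in> S \<Longrightarrow> y \<in> S \<Longrightarrow> 0 \<le> t \<Longrightarrow> t \<le> 1
           \<Longrightarrow> (\<lambda>i. (1 - t) * x i + t * y i) \<in> S"
  shows "connectedin (Euclidean_space n) S"
proof -
  have "\<exists>g. pathin (Euclidean_space n) g \<and> g \<in> {0..1} \<rightarrow> S \<and> g 0 = x \<and> g 1 = y"
    if "x \<in> S" "y \<in> S" for x y
  proof (intro exI conjI)
    let ?g = "\<lambda>t i. (1 - t) * x i + t * y i"
    show "pathin (Euclidean_space n) ?g"
      unfolding pathin_def
      by (intro continuous_map_from_subtopology segment_continuous_Euclidean_space)
         (use that assms(1) in auto)
    show "?g \<in> {0..1} \<rightarrow> S"
      using assms(2)[OF that] by auto
  qed (auto simp: fun_eq_iff)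
  then show ?thesis
    using assms(1) by (intro path_connectedin_imp_connectedin) (auto simp: path_connectedin)
qed

lemma convex_combination_bounds:
  fixes u v t :: real
  assumes "0 \<le> t" "t \<le> 1"
  shows "c \<le> u \<Longrightarrow> c \<le> v \<Longrightarrow> c \<le> (1 - t) * u + t * v"
    and "u \<le> c \<Longrightarrow> v \<le> c \<Longrightarrow> (1 - t) * u + t * v \<le> c"
    and "c < u \<Longrightarrow> c < v \<Longrightarrow> c < (1 - t) * u + t * v"
    and "u < c \<Longrightarrow> v < c \<Longrightarrow> (1 - t) * u + t * v < c"
proof -
  show "c \<le> u \<Longrightarrow> c \<le> v \<Longrightarrow> c \<le> (1 - t) * u + t * v"
    using mult_left_mono[of c u "1 - t"] mult_left_mono[of c v t] assms by (auto simp: algebra_simps)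
  show "u \<le> c \<Longrightarrow> v \<le> c \<Longrightarrow> (1 - t) * u + t * v \<le> c"
    using mult_left_mono[of u c "1 - t"] mult_left_mono[of v c t] assms by (auto simp: algebra_simps)
  show "c < u \<Longrightarrow> c < v \<Longrightarrow> c < (1 - t) * u + t * v"
    using convex_bound_lt[of "-u" "-c" "-v" "1 - t" t] assms by simp
  show "u < c \<Longrightarrow> v < c \<Longrightarrow> (1 - t) * u + t * v < c"
    using convex_bound_lt[of u c v "1 - t" t] assms by simp
qed

text \<open>The open ball of the maximum norm on the first \<open>n\<close> coordinates.\<close>

definition open_box :: "nat \<Rightarrow> (nat \<Rightarrow> real) \<Rightarrow> real \<Rightarrow> (nat \<Rightarrow> real) set" where
  "open_box n c r = {w \<in> topspace (Euclidean_space n). \<forall>i<n. \<bar>w i - c i\<bar> < r}"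

lemma openin_open_box: "openin (Euclidean_space n) (open_box n c r)"
proof -
  have "open {w. \<forall>i\<in>{..<n}. \<bar>w i - c i\<bar> < r}"
    by (subst Collect_ball_eq, intro open_INT ballI open_Collect_less continuous_intros
        continuous_on_product_coordinates) auto
  then have "openin (top_of_set (topspace (Euclidean_space n)))
               (topspace (Euclidean_space n) \<inter> {w. \<forall>i\<in>{..<n}. \<bar>w i - c i\<bar> < r})"
    by (rule openin_open_Int)
  moreover have "topspace (Euclidean_space n) \<inter> {w. \<forall>i\<in>{..<n}. \<bar>w i - c i\<bar> < r} = open_box n c r"
    by (auto simp: open_box_def)
  ultimately show ?thesis
    by (metis Euclidean_space_def euclidean_product_topology topspace_Euclidean_space)
qed

lemma open_box_neighbourhood:
  assumes "openin (Euclidean_space n) O'" "z \<in> O'"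
  obtains r where "r > 0" "open_box n z r \<subseteq> O'"
proof -
  have zE: "z \<in> topspace (Euclidean_space n)"
    using assms openin_subset by blast
  obtain T where T: "openin (powertop_real UNIV) T" "O' = T \<inter> {x. \<forall>i\<ge>n. x i = 0}"
    using assms(1) unfolding Euclidean_space_def openin_subtopology by blast
  with assms have "z \<in> T" by blast
  then obtain U where U: "\<And>i. open (U i :: real set)" "z \<in> Pi\<^sub>E UNIV U" "Pi\<^sub>E UNIV U \<subseteq> T"
    using T(1) unfolding openin_product_topology_alt by (metis UNIV_I open_openin)
  have "\<exists>r>0. \<forall>u. \<bar>u - z i\<bar> < r \<longrightarrow> u \<in> U i" for i
    using U(1)[of i] U(2) unfolding open_dist by (auto simp: dist_real_def PiE_iff)
  then obtain r where r: "\<And>i. r i > 0" "\<And>i u. \<bar>u - z i\<bar> < r i \<Longrightarrow> u \<in> U i"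
    by metis
  define q where "q = Min (insert 1 (r ` {..<n}))"
  have q: "q \<le> r i" if "i < n" for i
    using that by (auto simp: q_def)
  have "q > 0"
    using r(1) by (auto simp: q_def)
  moreover have "open_box n z q \<subseteq> O'"
  proof
    fix w assume w: "w \<in> open_box n z q"
    have "w i \<in> U i" for i
    proof (cases "i < n")
      case True
      then show ?thesis
        using w q[OF True] by (intro r(2)) (auto simp: open_box_def)
    next
      case False
      then have "w i = z i"
        using w zE by (auto simp: open_box_def topspace_Euclidean_space)
      then show ?thesis
        using r by simp
    qed
    with U(3) have "w \<in> T" by (auto simp: PiE_iff)
    with w T(2) show "w \<in> O'"
      by (auto simp: open_box_def topspace_Euclidean_space)
  qed
  ultimately show thesis
    using that by blast
qed

text \<open>Coordinatewise, \<open>u \<mapsto> u / (r - \<bar>u\<bar>)\<close> maps \<open>(-r, r)\<close> homeomorphically onto the line; the inverse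
is \<open>y \<mapsto> r y / (1 + \<bar>y\<bar>)\<close>. An interior point must have a neighbourhood homeomorphic to the whole
of \<open>\<real>\<^sup>n\<close>, and boxes supply it inside any open set.\<close>

lemma open_box_homeomorphic_Euclidean_space:
  assumes "r > 0"
  shows "subtopology (Euclidean_space n) (open_box n c r) homeomorphic_space Euclidean_space n"
proof -
  define g where "g x = (\<lambda>i. if i < n then (x i - c i) / (r - \<bar>x i - c i\<bar>) else 0)" for x :: "nat \<Rightarrow> real"
  define h where "h y = (\<lambda>i. if i < n then c i + r * y i / (1 + \<bar>y i\<bar>) else 0)" for y :: "nat \<Rightarrow> real"
  have gh: "u / (r - \<bar>u\<bar>) = y" if "u = r * y / (1 + \<bar>y\<bar>)" for u y
  proof -
    have 1: "\<bar>u\<bar> = r * \<bar>y\<bar> / (1 + \<bar>y\<bar>)"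
      using that assms by (simp add: abs_mult)
    have "r - \<bar>u\<bar> = r / (1 + \<bar>y\<bar>)"
      unfolding 1 by (simp add: field_simps)
    then show ?thesis
      using that assms by simp
  qed
  have hg: "r * y / (1 + \<bar>y\<bar>) = u" if "y = u / (r - \<bar>u\<bar>)" "\<bar>u\<bar> < r" for u y
  proof -
    have 1: "\<bar>y\<bar> = \<bar>u\<bar> / (r - \<bar>u\<bar>)"
      using that by simp
    have "1 + \<bar>y\<bar> = r / (r - \<bar>u\<bar>)"
      unfolding 1 using that by (simp add: field_simps)
    then show ?thesis
      using that assms by simp
  qed
  have hb: "\<bar>r * y / (1 + \<bar>y\<bar>)\<bar> < r" for y
    using assms by (simp add: abs_mult field_simps)
  have "homeomorphic_maps (subtopology (Euclidean_space n) (open_box n c r)) (Euclidean_space n) g h"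
    unfolding homeomorphic_maps_def
  proof (intro conjI ballI)
    show "continuous_map (subtopology (Euclidean_space n) (open_box n c r)) (Euclidean_space n) g"
      unfolding g_def continuous_map_componentwise_Euclidean_space
      by (intro allI impI continuous_intros coordinate_continuous_Euclidean_space)
         (auto simp: open_box_def)
    have "continuous_map (Euclidean_space n) (Euclidean_space n) h"
      unfolding h_def continuous_map_componentwise_Euclidean_space
      using coordinate_continuous_Euclidean_space[of n UNIV]
      by (intro allI impI continuous_intros) (auto simp: add_nonneg_eq_0_iff)
    moreover have "h y \<in> open_box n c r" for y
      using hb by (auto simp: open_box_def topspace_Euclidean_space h_def)
    ultimately show "continuous_map (Euclidean_space n) (subtopology (Euclidean_space n) (open_box n c r)) h"
      by (auto simp: continuous_map_in_subtopology)
    show "h (g x) = x" if "x \<in> topspace (subtopology (Euclidean_space n) (open_box n c r))" for x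
    proof
      fix i
      show "h (g x) i = x i"
      proof (cases "i < n")
        case True
        then have "\<bar>x i - c i\<bar> < r"
          using that by (simp add: open_box_def)
        from hg[OF refl this] True show ?thesis
          by (simp add: h_def g_def)
      qed (use that in \<open>auto simp: h_def topspace_Euclidean_space\<close>)
    qed
    show "g (h y) = y" if "y \<in> topspace (Euclidean_space n)" for y
      using that gh by (auto simp: h_def g_def topspace_Euclidean_space fun_eq_iff)
  qed
  then show ?thesis
    by (auto simp: homeomorphic_space_def)
qed

section \<open>Lifting maps through a local homeomorphism\<close>

text \<open>Uniqueness of lifts: the set where two lifts agree is closed because \<open>X\<close> is Hausdorff and open
because \<open>f\<close> is locally injective.\<close>

lemma lifts_agree:
  assumes "connected_space Z" "Hausdorff_space X"
    and g: "continuous_map Z X g" and h: "continuous_map Z X h"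
    and fgh: "\<And>z. z \<in> topspace Z \<Longrightarrow> f (g z) = f (h z)"
    and inj: "\<And>z. z \<in> topspace Z \<Longrightarrow> \<exists>U. openin X U \<and> g z \<in> U \<and> inj_on f U"
    and a: "a \<in> topspace Z" "g a = h a" and z: "z \<in> topspace Z"
  shows "g z = h z"
proof -
  let ?E = "{z \<in> topspace Z. g z = h z}"
  have "closedin Z ?E"
    using assms(2) g h closedin_continuous_maps_eq by blast
  moreover have "openin Z ?E"
  proof (subst openin_subopen, intro ballI)
    fix w assume w: "w \<in> ?E"
    then obtain U where U: "openin X U" "g w \<in> U" "inj_on f U"
      using inj by blast
    let ?T = "{v \<in> topspace Z. g v \<in> U} \<inter> {v \<in> topspace Z. h v \<in> U}"
    have "openin Z ?T"
      using g h U(1) openin_continuous_map_preimage by blast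
    moreover have "w \<in> ?T"
      using w U(2) by auto
    moreover have "?T \<subseteq> ?E"
      using U(3) fgh by (auto dest: inj_onD)
    ultimately show "\<exists>T. openin Z T \<and> w \<in> T \<and> T \<subseteq> ?E"
      by blast
  qed
  ultimately have "?E = {} \<or> ?E = topspace Z"
    using assms(1) connected_space_clopen_in by blast
  with a z show ?thesis by blast
qed

text \<open>A map from a compact space that is a local homeomorphism over a part \<open>G\<close> of its target, as it
will be over the interior of \<open>Y\<close> but not over its boundary. Compactness of \<open>X\<close> replaces
properness: no preimages can escape as a point of \<open>G\<close> varies.\<close>

locale compact_local_homeomorphism =
  fixes X :: "'a topology" and Y :: "'b topology" and f :: "'a \<Rightarrow> 'b" and G :: "'b set"
  assumes compact: "compact_space X"
    and Hausdorff_X: "Hausdorff_space X" and Hausdorff_Y: "Hausdorff_space Y"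
    and continuous: "continuous_map X Y f"
    and locally_homeomorphic:
      "\<And>x. x \<in> topspace X \<Longrightarrow> f x \<in> G \<Longrightarrow>
         \<exists>U. openin X U \<and> x \<in> U \<and> inj_on f U \<and> open_map (subtopology X U) Y f"
begin

lemma closed_image: "closedin X C \<Longrightarrow> closedin Y (f ` C)"
  using continuous_imp_closed_map[OF continuous compact Hausdorff_Y] by (simp add: closed_map_def)

text \<open>Over \<open>G\<close> the image is open, since \<open>f\<close> is locally open, and closed, since \<open>X\<close> is compact.\<close>

lemma image_contains_connected:
  assumes "connectedin Y G" and "x \<in> topspace X" "f x \<in> G"
  shows "G \<subseteq> f ` topspace X"
proof -
  define E where "E = \<Union>{f ` U |U. openin X U \<and> openin Y (f ` U)}"
  have E: "openin Y E"
    unfolding E_def by auto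
  have out: "openin Y (topspace Y - f ` topspace X)"
    using closed_image[OF closedin_topspace] by blast
  have inE: "f z \<in> E" if z: "z \<in> topspace X" "f z \<in> G" for z
  proof -
    obtain U where U: "openin X U" "z \<in> U" "open_map (subtopology X U) Y f"
      using locally_homeomorphic[OF z] by blast
    have "openin (subtopology X U) U"
      using U(1) by (simp add: openin_open_subtopology)
    then have "openin Y (f ` U)"
      using U(3) by (simp add: open_map_def)
    with U(1,2) show ?thesis
      unfolding E_def by blast
  qed
  have GY: "G \<subseteq> topspace Y"
    by (rule connectedin_subset_topspace[OF assms(1)])
  have cover: "G \<subseteq> E \<union> (topspace Y - f ` topspace X)"
    using inE GY by auto
  have "E \<subseteq> f ` topspace X"
    unfolding E_def using openin_subset by blast
  then have disjoint: "E \<inter> (topspace Y - f ` topspace X) \<inter> G = {}"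
    by blast
  have "E \<inter> G \<noteq> {}"
    using inE[OF assms(2,3)] assms(3) by blast
  then have "(topspace Y - f ` topspace X) \<inter> G = {}"
    using connectedinD[OF assms(1) E out cover disjoint] by blast
  then show ?thesis
    using GY by blast
qed

text \<open>The points with at least two preimages are interior to such points, because disjoint neighbourhoods
of two preimages have overlapping open images. The points with at most one preimage \<open>x\<close> are interior
to such points, because \<open>f\<close> is injective on a neighbourhood \<open>U\<close> of \<open>x\<close> and the complement of \<open>U\<close>
has a closed image; a point without preimage lies in the open complement of the image.
Connectedness of \<open>G\<close> rules out one of the two kinds.\<close>

lemma injective_over_connected:
  assumes G: "connectedin Y G"
    and W: "openin Y W" "W \<inter> G \<noteq> {}" "inj_on f {x \<in> topspace X. f x \<in> W}"
  shows "inj_on f {x \<in> topspace X. f x \<in> G}"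
proof -
  define A where "A = \<Union>{V. openin Y V \<and> inj_on f {x \<in> topspace X. f x \<in> V}}"
  define B where "B = \<Union>{f ` U \<inter> f ` U' |U U'. openin X U \<and> openin X U' \<and> U \<inter> U' = {} \<and>
                          openin Y (f ` U) \<and> openin Y (f ` U')}"
  have A: "openin Y A"
    unfolding A_def by auto
  have B: "openin Y B"
    unfolding B_def by auto
  have AB: "A \<inter> B \<inter> G = {}"
  proof (rule ccontr)
    assume "A \<inter> B \<inter> G \<noteq> {}"
    then obtain V U U' y where V: "inj_on f {x \<in> topspace X. f x \<in> V}" "y \<in> V"
      and U: "openin X U" "openin X U'" "U \<inter> U' = {}" "y \<in> f ` U" "y \<in> f ` U'"
      unfolding A_def B_def by blast
    then obtain x x' where x: "x \<in> U" "x' \<in> U'" "y = f x" "y = f x'"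
      by blast
    moreover have "x \<in> topspace X" "x' \<in> topspace X"
      using x U(1,2) openin_subset by blast+
    ultimately have "x = x'"
      using V by (auto dest: inj_onD)
    with x U(3) show False by blast
  qed
  have inB: "f x \<in> B"
    if x: "x \<in> topspace X" "x' \<in> topspace X" "f x = f x'" "f x \<in> G" "x \<noteq> x'" for x x'
  proof -
    obtain U where U: "openin X U" "x \<in> U" "open_map (subtopology X U) Y f"
      using locally_homeomorphic[of x] x by blast
    obtain U' where U': "openin X U'" "x' \<in> U'" "open_map (subtopology X U') Y f"
      using locally_homeomorphic[of x'] x by auto
    obtain N N' where N: "openin X N" "openin X N'" "x \<in> N" "x' \<in> N'" "disjnt N N'"
      using Hausdorff_X x unfolding Hausdorff_space_def by blast
    have "openin (subtopology X U) (U \<inter> N)" "openin (subtopology X U') (U' \<inter> N')"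
      using U(1) U'(1) N(1,2) by (auto simp: openin_open_subtopology)
    then have "openin Y (f ` (U \<inter> N))" "openin Y (f ` (U' \<inter> N'))"
      using U(3) U'(3) unfolding open_map_def by blast+
    moreover have "openin X (U \<inter> N)" "openin X (U' \<inter> N')" "(U \<inter> N) \<inter> (U' \<inter> N') = {}"
      using U(1) U'(1) N by (auto simp: disjnt_def)
    moreover have "f x \<in> f ` (U \<inter> N) \<inter> f ` (U' \<inter> N')"
      using U(2) U'(2) N x(3) by blast
    ultimately show ?thesis
      unfolding B_def by blast
  qed
  have cover: "G \<subseteq> A \<union> B"
  proof
    fix y assume y: "y \<in> G"
    then have yY: "y \<in> topspace Y"
      using G connectedin_subset_topspace by blast
    show "y \<in> A \<union> B"
    proof (cases "\<exists>x\<in>topspace X. f x = y")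
      case False
      have "openin Y (topspace Y - f ` topspace X)"
        using closed_image[OF closedin_topspace] by blast
      moreover have "inj_on f {x \<in> topspace X. f x \<in> topspace Y - f ` topspace X}"
        by (auto simp: inj_on_def)
      ultimately show ?thesis
        unfolding A_def using False yY by blast
    next
      case True
      then obtain x where x: "x \<in> topspace X" "f x = y" by blast
      show ?thesis
      proof (cases "\<exists>x'\<in>topspace X. f x' = y \<and> x' \<noteq> x")
        case True
        then obtain x' where x': "x' \<in> topspace X" "f x' = y" "x' \<noteq> x" by blast
        have "f x \<in> B"
          by (rule inB[of x x']) (use x x' y in auto)
        then show ?thesis using x(2) by blast
      next
        case False
        obtain U where U: "openin X U" "x \<in> U" "inj_on f U"
          using locally_homeomorphic[of x] x y by blast
        let ?V = "topspace Y - f ` (topspace X - U)"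
        have "openin Y ?V"
          using closed_image[of "topspace X - U"] U(1) by blast
        moreover have "y \<in> ?V"
          using False U(2) yY by blast
        moreover have "inj_on f {x \<in> topspace X. f x \<in> ?V}"
          by (rule inj_on_subset[OF U(3)]) blast
        ultimately show ?thesis
          unfolding A_def by blast
      qed
    qed
  qed
  have "W \<subseteq> A"
    unfolding A_def using W(1,3) by (intro Union_upper) simp
  then have "A \<inter> G \<noteq> {}"
    using W(2) by blast
  then have "B \<inter> G = {}"
    using connectedinD[OF G A B cover AB] by blast
  show ?thesis
  proof (rule inj_onI, rule ccontr)
    fix x x' assume x: "x \<in> {x \<in> topspace X. f x \<in> G}" "x' \<in> {x \<in> topspace X. f x \<in> G}"
      "f x = f x'" "x \<noteq> x'"
    then have "f x \<in> B"
      by (intro inB[of x x']) auto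
    with x(1) \<open>B \<inter> G = {}\<close> show False by blast
  qed
qed

text \<open>Finitely many open sets on which \<open>f\<close> is a homeomorphism onto an open set cover the fibre over
\<open>y\<close>. Near \<open>y\<close> each of them is mapped onto all of \<open>V\<close>, and no point outside them is mapped
into \<open>V\<close>. The inverse of \<open>f\<close> on the one that contains \<open>e\<close> is the section through \<open>e\<close>.\<close>

lemma local_section:
  assumes "y \<in> topspace Y" "y \<in> G"
  obtains V where "openin Y V" "y \<in> V"
    "\<And>e. e \<in> topspace X \<Longrightarrow> f e \<in> V \<Longrightarrow>
       \<exists>s. continuous_map (subtopology Y V) X s \<and> (\<forall>v\<in>V. f (s v) = v) \<and> s (f e) = e"
proof -
  let ?F = "{x \<in> topspace X. f x \<in> {y}}"
  have "closedin X ?F"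
    using closedin_continuous_map_preimage[OF continuous] closedin_Hausdorff_singleton[OF Hausdorff_Y]
      assms(1) by blast
  then have "compactin X ?F"
    using compact closedin_compact_space by blast
  have "\<forall>x\<in>?F. \<exists>U. openin X U \<and> x \<in> U \<and> inj_on f U \<and> open_map (subtopology X U) Y f"
    using locally_homeomorphic assms(2) by blast
  from bchoice[OF this] obtain U where
    U: "\<And>x. x \<in> ?F \<Longrightarrow> openin X (U x)" "\<And>x. x \<in> ?F \<Longrightarrow> x \<in> U x"
    "\<And>x. x \<in> ?F \<Longrightarrow> inj_on f (U x)" "\<And>x. x \<in> ?F \<Longrightarrow> open_map (subtopology X (U x)) Y f"
    by blast
  have "\<exists>\<F>. finite \<F> \<and> \<F> \<subseteq> U ` ?F \<and> ?F \<subseteq> \<Union>\<F>"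
    by (rule compactinD[OF \<open>compactin X ?F\<close>]) (use U in auto)
  then obtain \<F> where \<F>: "finite \<F>" "\<F> \<subseteq> U ` ?F" "?F \<subseteq> \<Union>\<F>"
    by blast
  from finite_subset_image[OF \<F>(1,2)] \<F>(3)
  obtain K where K: "finite K" "K \<subseteq> ?F" "?F \<subseteq> \<Union>(U ` K)"
    by blast
  define V where "V = (topspace Y \<inter> (\<Inter>x\<in>K. f ` U x)) - f ` (topspace X - \<Union>(U ` K))"
  have fU: "openin Y (f ` U x)" if "x \<in> K" for x
  proof -
    have "openin (subtopology X (U x)) (U x)"
      using U(1) K(2) that by (meson openin_open_subtopology subset_refl subsetD)
    then show ?thesis
      using U(4) K(2) that unfolding open_map_def by blast
  qed
  have "openin Y (topspace Y \<inter> (\<Inter>x\<in>K. f ` U x))"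
    using openin_INT[OF K(1), of Y "\<lambda>x. f ` U x"] fU by (simp add: Int_commute)
  moreover have "closedin Y (f ` (topspace X - \<Union>(U ` K)))"
    using U(1) K(2) by (intro closed_image closedin_diff) auto
  ultimately have "openin Y V"
    unfolding V_def by (rule openin_diff)
  moreover have "y \<in> V"
    using assms(1) K U(2) unfolding V_def by fastforce
  moreover have "\<exists>s. continuous_map (subtopology Y V) X s \<and> (\<forall>v\<in>V. f (s v) = v) \<and> s (f e) = e"
    if e: "e \<in> topspace X" "f e \<in> V" for e
  proof -
    obtain x where x: "x \<in> K" "e \<in> U x"
      using e unfolding V_def by blast
    then have xF: "x \<in> ?F" using K by blast
    have sub: "U x \<subseteq> topspace X"
      using U(1)[OF xF] openin_subset by blast
    have "embedding_map (subtopology X (U x)) Y f"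
    proof (rule injective_open_imp_embedding_map)
      show "inj_on f (topspace (subtopology X (U x)))"
        using U(3)[OF xF] inj_on_subset by fastforce
    qed (use U(4)[OF xF] continuous continuous_map_from_subtopology in blast)+
    then have "homeomorphic_map (subtopology X (U x)) (subtopology Y (f ` U x)) f"
      using sub by (simp add: embedding_map_def inf_absorb2)
    then obtain s where s: "homeomorphic_maps (subtopology X (U x)) (subtopology Y (f ` U x)) f s"
      using homeomorphic_map_maps by blast
    have VfU: "V \<subseteq> f ` U x" and "V \<subseteq> topspace Y"
      using x(1) by (auto simp: V_def)
    have "continuous_map (subtopology Y (f ` U x)) X s"
      using s by (auto simp: homeomorphic_maps_def continuous_map_in_subtopology)
    then have "continuous_map (subtopology Y V) X s"
      using VfU continuous_map_from_subtopology_mono by blast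
    moreover have "\<forall>v\<in>V. f (s v) = v" "s (f e) = e"
      using s VfU \<open>V \<subseteq> topspace Y\<close> sub x(2) by (auto simp: homeomorphic_maps_def)
    ultimately show ?thesis by blast
  qed
  ultimately show thesis
    using that by blast
qed

text \<open>Over the image of \<open>S\<close> the pull-back of \<open>f\<close> along \<open>\<eta>\<close> has a section through each of its
points; this is the form in which triviality of a covering is used.\<close>

definition liftable :: "'c topology \<Rightarrow> ('c \<Rightarrow> 'b) \<Rightarrow> 'c set \<Rightarrow> bool" where
  "liftable Z \<eta> S \<longleftrightarrow>
     (\<forall>z\<in>S. \<forall>e\<in>topspace X. f e = \<eta> z \<longrightarrow>
        (\<exists>s. continuous_map (subtopology Z S) X s \<and> (\<forall>w\<in>S. f (s w) = \<eta> w) \<and> s z = e))"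

lemma liftable_subset: "liftable Z \<eta> S \<Longrightarrow> T \<subseteq> S \<Longrightarrow> liftable Z \<eta> T"
  unfolding liftable_def by (meson continuous_map_from_subtopology_mono subsetD)

lemma liftable_neighbourhood:
  assumes \<eta>: "continuous_map Z Y \<eta>" and "z \<in> topspace Z" "\<eta> z \<in> G"
  obtains N where "openin Z N" "z \<in> N" "liftable Z \<eta> N"
proof -
  have "\<eta> z \<in> topspace Y"
    using assms continuous_map_funspace by fastforce
  then obtain V where V: "openin Y V" "\<eta> z \<in> V"
    "\<And>e. e \<in> topspace X \<Longrightarrow> f e \<in> V \<Longrightarrow>
       \<exists>s. continuous_map (subtopology Y V) X s \<and> (\<forall>v\<in>V. f (s v) = v) \<and> s (f e) = e"
    using local_section assms by metis
  let ?N = "{w \<in> topspace Z. \<eta> w \<in> V}"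
  have "openin Z ?N"
    using \<eta> V(1) openin_continuous_map_preimage by blast
  moreover have "z \<in> ?N"
    using assms V by auto
  moreover have "liftable Z \<eta> ?N"
    unfolding liftable_def
  proof (intro ballI impI)
    fix w e assume w: "w \<in> ?N" and e: "e \<in> topspace X" "f e = \<eta> w"
    then obtain s where s: "continuous_map (subtopology Y V) X s" "\<forall>v\<in>V. f (s v) = v" "s (f e) = e"
      using V(3)[of e] by auto
    have "continuous_map (subtopology Z ?N) (subtopology Y V) \<eta>"
      using \<eta> by (auto simp: continuous_map_in_subtopology continuous_map_from_subtopology)
    then have "continuous_map (subtopology Z ?N) X (s \<circ> \<eta>)"
      using s(1) continuous_map_compose by blast
    with s e show "\<exists>s. continuous_map (subtopology Z ?N) X s \<and> (\<forall>w\<in>?N. f (s w) = \<eta> w) \<and> s w = e"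
      by (intro exI[of _ "s \<circ> \<eta>"]) auto
  qed
  ultimately show thesis
    using that by blast
qed

text \<open>A lift over \<open>S\<close> is continued over \<open>T\<close> by the lift that agrees with it at one common point; on the
connected overlap the two agree everywhere by uniqueness of lifts.\<close>

lemma liftable_Un:
  assumes lift: "liftable Z \<eta> S" "liftable Z \<eta> T"
    and clo: "closedin Z S" "closedin Z T"
    and conn: "connectedin Z (S \<inter> T)" and "S \<inter> T \<noteq> {}" and G: "\<eta> ` (S \<inter> T) \<subseteq> G"
  shows "liftable Z \<eta> (S \<union> T)"
proof -
  obtain c where c: "c \<in> S" "c \<in> T"
    using assms(6) by blast
  have *: "\<exists>s. continuous_map (subtopology Z (S \<union> T)) X s \<and> (\<forall>w\<in>S \<union> T. f (s w) = \<eta> w) \<and> s z = e"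
    if lift: "liftable Z \<eta> S" "liftable Z \<eta> T"
      and clo: "closedin Z S" "closedin Z T"
      and conn: "connectedin Z (S \<inter> T)" and G: "\<eta> ` (S \<inter> T) \<subseteq> G"
      and c: "c \<in> S" "c \<in> T"
      and z: "z \<in> S" and e: "e \<in> topspace X" "f e = \<eta> z" for S T z e
  proof -
    have sub: "S \<subseteq> topspace Z" "T \<subseteq> topspace Z"
      using clo closedin_subset by auto
    obtain s where s: "continuous_map (subtopology Z S) X s" "\<forall>w\<in>S. f (s w) = \<eta> w" "s z = e"
      using lift(1) z e unfolding liftable_def by blast
    have "s c \<in> topspace X"
      using s(1) c sub by (auto simp: continuous_map_def)
    moreover have "f (s c) = \<eta> c"
      using s(2) c by blast
    ultimately obtain s' where s': "continuous_map (subtopology Z T) X s'" "\<forall>w\<in>T. f (s' w) = \<eta> w"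
      "s' c = s c"
      using lift(2) c unfolding liftable_def by blast
    have agree: "s w = s' w" if "w \<in> S \<inter> T" for w
    proof (rule lifts_agree[where Z = "subtopology Z (S \<inter> T)" and X = X and f = f and a = c])
      show "continuous_map (subtopology Z (S \<inter> T)) X s" "continuous_map (subtopology Z (S \<inter> T)) X s'"
        using s(1) s'(1) continuous_map_from_subtopology_mono by (metis inf_le1, metis inf_le2)
      show "connected_space (subtopology Z (S \<inter> T))"
        using conn by (simp add: connectedin_def)
      fix v assume "v \<in> topspace (subtopology Z (S \<inter> T))"
      then have v: "v \<in> S" "v \<in> T" by auto
      show "f (s v) = f (s' v)"
        using v s(2) s'(2) by simp
      have "s v \<in> topspace X"
        using s(1) v sub by (auto simp: continuous_map_def)
      moreover have "f (s v) \<in> G"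
        using v s(2) G by auto
      ultimately show "\<exists>U. openin X U \<and> s v \<in> U \<and> inj_on f U"
        using locally_homeomorphic by blast
    qed (use Hausdorff_X that c s'(3) sub in auto)
    define u where "u w = (if w \<in> S then s w else s' w)" for w
    have "continuous_map (subtopology Z (S \<union> T)) X u"
    proof (rule pasting_lemma_closed[where I = UNIV and T = "\<lambda>b. if b then S else T"
          and f = "\<lambda>b. if b then s else s'"])
      show "closedin (subtopology Z (S \<union> T)) (if b then S else T)" for b
        using clo by (auto intro: closedin_subset_topspace)
      show "continuous_map (subtopology (subtopology Z (S \<union> T)) (if b then S else T)) X
              (if b then s else s')" for b
        using s(1) s'(1) by (simp add: subtopology_subtopology Int_absorb1)
      show "(if i then s else s') x = (if j then s else s') x"
        if "x \<in> topspace (subtopology Z (S \<union> T)) \<inter> (if i then S else T) \<inter> (if j then S else T)"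
        for i j x
        using that agree by (auto split: if_splits)
      show "\<exists>j. j \<in> UNIV \<and> x \<in> (if j then S else T) \<and> u x = (if j then s else s') x"
        if "x \<in> topspace (subtopology Z (S \<union> T))" for x
        using that by (intro exI[of _ "x \<in> S"]) (auto simp: u_def)
    qed auto
    moreover have "\<forall>w\<in>S \<union> T. f (u w) = \<eta> w" "u z = e"
      using s s' z by (auto simp: u_def)
    ultimately show ?thesis by blast
  qed
  show ?thesis
    unfolding liftable_def
  proof (intro ballI impI)
    fix z e assume "z \<in> S \<union> T" and e: "e \<in> topspace X" "f e = \<eta> z"
    then consider "z \<in> S" | "z \<in> T" by blast
    then show "\<exists>s. continuous_map (subtopology Z (S \<union> T)) X s \<and> (\<forall>w\<in>S \<union> T. f (s w) = \<eta> w) \<and> s z = e"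
    proof cases
      case 1
      then show ?thesis using *[OF lift clo conn G c 1 e] by blast
    next
      case 2
      then show ?thesis
        using *[OF lift(2,1) clo(2,1) _ _ c(2,1) 2 e] conn G by (simp add: Un_commute Int_commute)
    qed
  qed
qed

text \<open>Lifts exist over small boxes, and adjacent boxes meet in a convex set, so lifts can be glued
across a common face. The gluing is done one coordinate at a time: by induction on \<open>k\<close>, around each
point \<open>x\<close> of \<open>B\<close> there is a liftable slab that has full length in the first \<open>k\<close> coordinates
and is thin in the others. Bolzano's bisection principle in the \<open>k\<close>-th coordinate supplies the
induction step.\<close>

lemma liftable_box:
  fixes a b :: "nat \<Rightarrow> real" and n :: nat
  defines "B \<equiv> {z \<in> topspace (Euclidean_space n). \<forall>i<n. a i \<le> z i \<and> z i \<le> b i}"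
  assumes \<eta>: "continuous_map (subtopology (Euclidean_space n) B) Y \<eta>" and G: "\<eta> ` B \<subseteq> G"
  shows "liftable (subtopology (Euclidean_space n) B) \<eta> B"
proof -
  let ?Z = "subtopology (Euclidean_space n) B"
  have BE: "B \<subseteq> topspace (Euclidean_space n)"
    by (auto simp: B_def)
  then have topB: "topspace ?Z = B" by auto
  have lift_slab: "\<exists>d>0. liftable ?Z \<eta> {z\<in>B. \<forall>i. k \<le> i \<and> i < n \<longrightarrow> \<bar>z i - x i\<bar> \<le> d}"
    if "x \<in> B" "k \<le> n" for x k
    using that
  proof (induction k arbitrary: x)
    case 0
    then have "x \<in> topspace ?Z" "\<eta> x \<in> G"
      using topB G by auto
    then obtain N where N: "openin ?Z N" "x \<in> N" "liftable ?Z \<eta> N"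
      using liftable_neighbourhood[OF \<eta>] by blast
    then obtain O' where O': "openin (Euclidean_space n) O'" "N = O' \<inter> B"
      unfolding openin_subtopology by blast
    then obtain r where r: "r > 0" "open_box n x r \<subseteq> O'"
      using N(2) open_box_neighbourhood by blast
    have "{z\<in>B. \<forall>i. 0 \<le> i \<and> i < n \<longrightarrow> \<bar>z i - x i\<bar> \<le> r / 2} \<subseteq> N"
    proof clarsimp
      fix z assume z: "z \<in> B" "\<forall>i<n. \<bar>z i - x i\<bar> * 2 \<le> r"
      then have "\<forall>i<n. \<bar>z i - x i\<bar> < r"
        using r(1) by (smt (verit))
      then have "z \<in> open_box n x r"
        using z BE by (auto simp: open_box_def)
      then show "z \<in> N"
        using r O' z by blast
    qed
    then show ?case
      using N(3) r(1) liftable_subset by (intro exI[of _ "r / 2"]) auto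
  next
    case (Suc k)
    \<comment> \<open>\<open>R c d \<delta>\<close> has full length in the coordinates below \<open>k\<close>, runs from \<open>c\<close> to \<open>d\<close> in
      coordinate \<open>k\<close>, and is \<open>\<delta>\<close>-thin around \<open>x\<close> in the coordinates above \<open>k\<close>.\<close>
    define R where "R c d \<delta> = {z\<in>B. c \<le> z k \<and> z k \<le> d \<and> (\<forall>i. Suc k \<le> i \<and> i < n \<longrightarrow> \<bar>z i - x i\<bar> \<le> \<delta>)}"
      for c d \<delta>
    have RB: "R c d \<delta> \<subseteq> B" for c d \<delta> by (auto simp: R_def)
    have R_mono: "R c d \<delta> \<subseteq> R c d \<delta>'" if "\<delta> \<le> \<delta>'" for c d \<delta> \<delta>'
      using that by (fastforce simp: R_def)
    have R_closed: "closedin ?Z (R c d \<delta>)" for c d \<delta>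
    proof -
      have "closed {z :: nat \<Rightarrow> real. c \<le> z k \<and> z k \<le> d \<and> (\<forall>i. Suc k \<le> i \<and> i < n \<longrightarrow> \<bar>z i - x i\<bar> \<le> \<delta>)}"
        by (intro closed_Collect_conj closed_Collect_all closed_Collect_imp closed_Collect_le
            continuous_intros continuous_on_product_coordinates) auto
      then have "closedin (top_of_set B) (B \<inter> {z. c \<le> z k \<and> z k \<le> d \<and> (\<forall>i. Suc k \<le> i \<and> i < n \<longrightarrow> \<bar>z i - x i\<bar> \<le> \<delta>)})"
        by (rule closedin_closed_Int)
      moreover have "?Z = top_of_set B"
        using BE by (simp add: Euclidean_space_def euclidean_product_topology subtopology_subtopology
            topspace_Euclidean_space Int_absorb1)
      moreover have "B \<inter> {z. c \<le> z k \<and> z k \<le> d \<and> (\<forall>i. Suc k \<le> i \<and> i < n \<longrightarrow> \<bar>z i - x i\<bar> \<le> \<delta>)} = R c d \<delta>"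
        by (auto simp: R_def)
      ultimately show ?thesis by simp
    qed
    have R_connected: "connectedin ?Z (R c d \<delta>)" for c d \<delta>
    proof -
      have "connectedin (Euclidean_space n) (R c d \<delta>)"
      proof (rule connectedin_Euclidean_space_convex)
        fix u v :: "nat \<Rightarrow> real" and t :: real
        assume u: "u \<in> R c d \<delta>" and v: "v \<in> R c d \<delta>" and t: "0 \<le> t" "t \<le> 1"
        let ?w = "\<lambda>i. (1 - t) * u i + t * v i"
        have "?w \<in> B"
          using u v convex_combination_bounds(1,2)[OF t]
          by (auto simp: R_def B_def topspace_Euclidean_space)
        moreover have "\<bar>?w i - x i\<bar> \<le> \<delta>" if i: "Suc k \<le> i" "i < n" for i
        proof -
          have "x i - \<delta> \<le> u i" "u i \<le> x i + \<delta>" "x i - \<delta> \<le> v i" "v i \<le> x i + \<delta>"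
            using u v i by (auto simp: R_def abs_le_iff algebra_simps dest!: spec[of _ i])
          then have "x i - \<delta> \<le> ?w i" "?w i \<le> x i + \<delta>"
            using convex_combination_bounds(1,2)[OF t] by blast+
          then show ?thesis by (simp add: abs_le_iff)
        qed
        moreover have "c \<le> ?w k" "?w k \<le> d"
          using u v convex_combination_bounds(1,2)[OF t] by (auto simp: R_def)
        ultimately show "?w \<in> R c d \<delta>"
          by (simp add: R_def)
      qed (use RB BE in blast)
      then show ?thesis
        using RB by (simp add: connectedin_subtopology)
    qed
    have "k < n" using Suc.prems by simp
    then have "a k \<le> x k" "x k \<le> b k"
      using Suc.prems(1) by (auto simp: B_def)
    then have "a k \<le> b k" by linarith
    then have "\<exists>\<delta>>0. liftable ?Z \<eta> (R (a k) (b k) \<delta>)"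
    proof (induction rule: Bolzano)
      case (trans c d e)
      then obtain \<delta>1 \<delta>2 where \<delta>: "\<delta>1 > 0" "\<delta>2 > 0" "liftable ?Z \<eta> (R c d \<delta>1)" "liftable ?Z \<eta> (R d e \<delta>2)"
        by blast
      define \<delta> where "\<delta> = min \<delta>1 \<delta>2"
      have "\<delta> > 0" and l: "liftable ?Z \<eta> (R c d \<delta>)" "liftable ?Z \<eta> (R d e \<delta>)"
        using \<delta>(1,2) liftable_subset[OF \<delta>(3) R_mono] liftable_subset[OF \<delta>(4) R_mono]
        by (auto simp: \<delta>_def intro: liftable_subset[OF _ R_mono])
      have un: "R c e \<delta> = R c d \<delta> \<union> R d e \<delta>"
        using trans(3,4) by (auto simp: R_def)
      have int: "R c d \<delta> \<inter> R d e \<delta> = R d d \<delta>"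
        using trans(3,4) by (auto simp: R_def)
      \<comment> \<open>The principle splits at arbitrary \<open>d\<close>; outside \<open>[a k, b k]\<close> one half is empty.\<close>
      consider "d < a k" | "b k < d" | "a k \<le> d" "d \<le> b k" by linarith
      then have "liftable ?Z \<eta> (R c e \<delta>)"
      proof cases
        case 1
        then have "R c d \<delta> = {}" using \<open>k < n\<close> by (force simp: R_def B_def)
        then show ?thesis using l un by simp
      next
        case 2
        then have "R d e \<delta> = {}" using \<open>k < n\<close> by (force simp: R_def B_def)
        then show ?thesis using l un by simp
      next
        case 3
        then have "x(k := d) \<in> R d d \<delta>"
          using Suc.prems \<open>k < n\<close> \<open>\<delta> > 0\<close> by (auto simp: R_def B_def topspace_Euclidean_space)
        then show ?thesis
          unfolding un using int G RB[of d d \<delta>]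
          by (intro liftable_Un l R_closed) (auto simp: R_connected)
      qed
      then show ?case using \<open>\<delta> > 0\<close> by blast
    next
      case (local t)
      then have "x(k := t) \<in> B"
        using Suc.prems \<open>k < n\<close> by (auto simp: B_def topspace_Euclidean_space)
      then obtain d where d: "d > 0"
        "liftable ?Z \<eta> {z\<in>B. \<forall>i. k \<le> i \<and> i < n \<longrightarrow> \<bar>z i - (x(k := t)) i\<bar> \<le> d}"
        using Suc.IH[of "x(k := t)"] Suc_leD[OF Suc.prems(2)] by blast
      have "R u v d \<subseteq> {z\<in>B. \<forall>i. k \<le> i \<and> i < n \<longrightarrow> \<bar>z i - (x(k := t)) i\<bar> \<le> d}"
        if "u \<le> t" "t \<le> v" "v - u < d" for u v
      proof
        fix z assume z: "z \<in> R u v d"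
        have "\<bar>z i - (x(k := t)) i\<bar> \<le> d" if "k \<le> i" "i < n" for i
        proof (cases "i = k")
          case True
          have "u \<le> z k" "z k \<le> v"
            using z by (auto simp: R_def)
          then show ?thesis
            using True \<open>u \<le> t\<close> \<open>t \<le> v\<close> \<open>v - u < d\<close> by simp
        next
          case False
          then have "Suc k \<le> i" using \<open>k \<le> i\<close> by simp
          then show ?thesis
            using False z \<open>i < n\<close> by (simp add: R_def)
        qed
        then show "z \<in> {z\<in>B. \<forall>i. k \<le> i \<and> i < n \<longrightarrow> \<bar>z i - (x(k := t)) i\<bar> \<le> d}"
          using z RB by blast
      qed
      then have thin: "\<exists>\<delta>>0. liftable ?Z \<eta> (R u v \<delta>)" if "u \<le> t \<and> t \<le> v \<and> v - u < d" for u v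
        by (intro exI[of _ d] conjI d(1) liftable_subset[OF d(2)]) (use that in simp_all)
      show ?case
        by (rule exI[of _ d]) (intro conjI allI impI d(1) thin, simp_all)
    qed
    then obtain \<delta> where \<delta>: "\<delta> > 0" "liftable ?Z \<eta> (R (a k) (b k) \<delta>)" by blast
    have R_full: "R (a k) (b k) \<delta> = {z\<in>B. \<forall>i. Suc k \<le> i \<and> i < n \<longrightarrow> \<bar>z i - x i\<bar> \<le> \<delta>}"
      using \<open>k < n\<close> by (auto simp: R_def B_def)
    from \<delta> show ?case
      unfolding R_full by (intro exI conjI)
  qed
  show ?thesis
  proof (cases "B = {}")
    case False
    then obtain x where "x \<in> B" by blast
    then obtain d where "liftable ?Z \<eta> {z\<in>B. \<forall>i. n \<le> i \<and> i < n \<longrightarrow> \<bar>z i - x i\<bar> \<le> d}"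
      using lift_slab by blast
    then show ?thesis by simp
  qed (simp add: liftable_def)
qed

end

section \<open>Interior and boundary of a topological manifold\<close>

text \<open>The model \<open>R\<close> is the whole space or a half-space; keeping it as a parameter lets both kinds of
charts be treated alike.\<close>

definition chart :: "nat \<Rightarrow> (nat \<Rightarrow> real) set \<Rightarrow> 'a topology \<Rightarrow> 'a set \<Rightarrow>
    ('a \<Rightarrow> nat \<Rightarrow> real) \<Rightarrow> ((nat \<Rightarrow> real) \<Rightarrow> 'a) \<Rightarrow> bool" where
  "chart n R Y V \<psi> \<psi>' \<longleftrightarrow> openin Y V \<and>
     homeomorphic_maps (subtopology Y V) (subtopology (Euclidean_space n) R) \<psi> \<psi>'"

abbreviation half_chart where
  "half_chart n \<equiv> chart n {x. 0 \<le> x 0}"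

lemma
  assumes "chart n R Y V \<psi> \<psi>'"
  shows chart_in: "v \<in> V \<Longrightarrow> \<psi> v \<in> topspace (Euclidean_space n) \<inter> R"
    and chart_inverse: "v \<in> V \<Longrightarrow> \<psi>' (\<psi> v) = v"
    and chart_inverse_in: "w \<in> topspace (Euclidean_space n) \<inter> R \<Longrightarrow> \<psi>' w \<in> V"
    and chart_right_inverse: "w \<in> topspace (Euclidean_space n) \<inter> R \<Longrightarrow> \<psi> (\<psi>' w) = w"
    and chart_continuous: "continuous_map (subtopology Y V) (Euclidean_space n) \<psi>"
    and chart_inverse_continuous: "continuous_map (subtopology (Euclidean_space n) R) Y \<psi>'"
    and chart_open: "openin Y V"
    and chart_subset: "V \<subseteq> topspace Y"
proof -
  have h: "homeomorphic_maps (subtopology Y V) (subtopology (Euclidean_space n) R) \<psi> \<psi>'"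
    and V: "openin Y V"
    using assms by (auto simp: chart_def)
  show "openin Y V" by (fact V)
  show sub: "V \<subseteq> topspace Y"
    using V openin_subset by blast
  have c: "continuous_map (subtopology Y V) (subtopology (Euclidean_space n) R) \<psi>"
    "continuous_map (subtopology (Euclidean_space n) R) (subtopology Y V) \<psi>'"
    using h by (auto simp: homeomorphic_maps_def)
  show "continuous_map (subtopology Y V) (Euclidean_space n) \<psi>"
    "continuous_map (subtopology (Euclidean_space n) R) Y \<psi>'"
    using c by (auto simp: continuous_map_in_subtopology)
  show "v \<in> V \<Longrightarrow> \<psi> v \<in> topspace (Euclidean_space n) \<inter> R"
    using c(1) sub by (auto simp: continuous_map_def)
  show "w \<in> topspace (Euclidean_space n) \<inter> R \<Longrightarrow> \<psi>' w \<in> V"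
    using c(2) by (auto simp: continuous_map_def)
  show "v \<in> V \<Longrightarrow> \<psi>' (\<psi> v) = v" "w \<in> topspace (Euclidean_space n) \<inter> R \<Longrightarrow> \<psi> (\<psi>' w) = w"
    using h sub by (auto simp: homeomorphic_maps_def)
qed

lemma chart_preimage_open:
  assumes "chart n R Y V \<psi> \<psi>'" "openin (Euclidean_space n) P"
  shows "openin Y (\<psi>' ` (P \<inter> R))"
proof -
  have "homeomorphic_map (subtopology (Euclidean_space n) R) (subtopology Y V) \<psi>'"
    using assms(1) homeomorphic_map_maps homeomorphic_maps_sym unfolding chart_def by blast
  moreover have "openin (subtopology (Euclidean_space n) R) (P \<inter> R)"
    using assms(2) openin_subtopology_Int by blast
  ultimately have "openin (subtopology Y V) (\<psi>' ` (P \<inter> R))"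
    using homeomorphic_imp_open_map open_map_def by blast
  then show ?thesis
    using assms(1) openin_trans_full unfolding chart_def by blast
qed

lemma chart_image_open:
  assumes "chart n R Y V \<psi> \<psi>'" "openin Y U" "U \<subseteq> V"
  obtains P where "openin (Euclidean_space n) P" "\<psi> ` U = P \<inter> R"
proof -
  have "homeomorphic_map (subtopology Y V) (subtopology (Euclidean_space n) R) \<psi>"
    using assms(1) homeomorphic_map_maps unfolding chart_def by blast
  moreover have "openin (subtopology Y V) U"
    using assms openin_subset_topspace_eq by (metis openin_subset openin_open_subtopology chart_def)
  ultimately have "openin (subtopology (Euclidean_space n) R) (\<psi> ` U)"
    using homeomorphic_imp_open_map open_map_def by blast
  then show thesis
    using that unfolding openin_subtopology by blast
qed

lemma full_chart_subset_interior:
  assumes "chart n UNIV Y V \<psi> \<psi>'"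
  shows "V \<subseteq> manifold_interior n Y"
proof -
  have "subtopology Y V homeomorphic_space Euclidean_space n"
    using assms by (auto simp: chart_def homeomorphic_space_def)
  with chart_open[OF assms] show ?thesis
    by (auto simp: manifold_interior_def)
qed

lemma manifold_chart:
  assumes "topological_manifold n Y" "y \<in> topspace Y"
  obtains (interior) V \<psi> \<psi>' where "y \<in> V" "chart n UNIV Y V \<psi> \<psi>'"
    | (half) V \<psi> \<psi>' where "y \<in> V" "half_chart n Y V \<psi> \<psi>'"
proof -
  from assms obtain V where V: "y \<in> V" "openin Y V"
    "subtopology Y V homeomorphic_space Euclidean_space n \<or>
     subtopology Y V homeomorphic_space Euclidean_half_space n"
    unfolding topological_manifold_def by blast
  from V(3) show thesis
  proof
    assume "subtopology Y V homeomorphic_space Euclidean_space n"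
    then obtain \<psi> \<psi>' where "homeomorphic_maps (subtopology Y V) (Euclidean_space n) \<psi> \<psi>'"
      by (auto simp: homeomorphic_space_def)
    with V show thesis
      by (intro interior) (auto simp: chart_def)
  next
    assume "subtopology Y V homeomorphic_space Euclidean_half_space n"
    then obtain \<psi> \<psi>' where "homeomorphic_maps (subtopology Y V) (Euclidean_half_space n) \<psi> \<psi>'"
      by (auto simp: homeomorphic_space_def)
    with V show thesis
      by (intro half) (auto simp: chart_def Euclidean_half_space_def)
  qed
qed

lemma manifold_interior_chart:
  assumes "y \<in> manifold_interior n Y"
  obtains V \<psi> \<psi>' where "y \<in> V" "chart n UNIV Y V \<psi> \<psi>'" "V \<subseteq> manifold_interior n Y"
proof -
  from assms obtain V where V: "y \<in> V" "openin Y V"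
    "subtopology Y V homeomorphic_space Euclidean_space n"
    unfolding manifold_interior_def by blast
  then obtain \<psi> \<psi>' where "homeomorphic_maps (subtopology Y V) (Euclidean_space n) \<psi> \<psi>'"
    by (auto simp: homeomorphic_space_def)
  with V show thesis
    using that[of V] by (auto simp: chart_def manifold_interior_def)
qed

lemma openin_manifold_interior: "openin Y (manifold_interior n Y)"
  by (subst openin_subopen) (metis manifold_interior_chart chart_def)

text \<open>In a chart the map \<open>g\<close> becomes a map between subsets of \<open>\<real>\<^sup>n\<close>. Invariance of domain gives
openness in \<open>\<real>\<^sup>n\<close> itself, which for a half-space chart is stronger than openness in the
half-space: the image cannot reach the bounding hyperplane.\<close>

lemma chart_Euclidean_map:
  assumes "chart n R Y V \<psi> \<psi>'" and P: "openin (Euclidean_space n) P"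
    and g: "continuous_map (subtopology (Euclidean_space n) P) Y g" and "inj_on g P"
    and gP: "g ` P \<subseteq> V"
  shows "openin (Euclidean_space n) (\<psi> ` g ` P)"
proof -
  have "continuous_map (subtopology (Euclidean_space n) P) (subtopology Y V) g"
    using g gP by (auto simp: continuous_map_in_subtopology)
  then have "continuous_map (subtopology (Euclidean_space n) P) (Euclidean_space n) (\<psi> \<circ> g)"
    using chart_continuous[OF assms(1)] continuous_map_compose by blast
  moreover have "inj_on (\<psi> \<circ> g) P"
  proof (rule comp_inj_on[OF assms(4)])
    show "inj_on \<psi> (g ` P)"
      using chart_inverse[OF assms(1)] gP by (metis inj_on_def subsetD)
  qed
  ultimately show ?thesis
    using invariance_of_domain_Euclidean_space[OF P] by (metis image_comp)
qed

text \<open>Around each \<open>g z\<close>, a chart image of \<open>g ` P\<close> contains a box that is open in \<open>\<real>\<^sup>n\<close> and lies in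
the model \<open>R\<close>. Its preimage under the chart is an open set homeomorphic to \<open>\<real>\<^sup>n\<close>.\<close>

theorem invariance_of_domain_manifold:
  assumes Y: "topological_manifold n Y" and P: "openin (Euclidean_space n) P"
    and g: "continuous_map (subtopology (Euclidean_space n) P) Y g" and inj: "inj_on g P"
  shows "openin Y (g ` P)" "g ` P \<subseteq> manifold_interior n Y"
proof -
  have *: "\<exists>W. openin Y W \<and> g z \<in> W \<and> W \<subseteq> g ` P \<inter> manifold_interior n Y" if z: "z \<in> P" for z
  proof -
    have PE: "P \<subseteq> topspace (Euclidean_space n)"
      using P openin_subset by blast
    have "g z \<in> topspace Y"
      using g z PE by (auto simp: continuous_map_def)
    then obtain V R \<psi> \<psi>' where V: "g z \<in> V" and ch: "chart n R Y V \<psi> \<psi>'"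
      using manifold_chart[OF Y] by metis
    define Q where "Q = {w \<in> topspace (subtopology (Euclidean_space n) P). g w \<in> V}"
    have QP: "Q \<subseteq> P" and gQ: "g ` Q \<subseteq> V" and zQ: "z \<in> Q"
      using z V PE by (auto simp: Q_def)
    have "openin (subtopology (Euclidean_space n) P) Q"
      unfolding Q_def by (rule openin_continuous_map_preimage[OF g chart_open[OF ch]])
    then have Q: "openin (Euclidean_space n) Q"
      using P openin_trans_full by blast
    have "openin (Euclidean_space n) (\<psi> ` g ` Q)"
      using chart_Euclidean_map[OF ch Q _ _ gQ] g inj QP
      by (meson continuous_map_from_subtopology_mono inj_on_subset)
    then obtain r where r: "r > 0" and box: "open_box n (\<psi> (g z)) r \<subseteq> \<psi> ` g ` Q"
      using open_box_neighbourhood zQ by (metis imageI)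
    let ?b = "open_box n (\<psi> (g z)) r"
    have bR: "?b \<subseteq> topspace (Euclidean_space n) \<inter> R"
      using box gQ chart_in[OF ch] by blast
    define W where "W = \<psi>' ` ?b"
    have W: "openin Y W"
      using chart_preimage_open[OF ch openin_open_box[of n "\<psi> (g z)" r]] bR
      by (simp add: W_def inf_absorb1)
    have WV: "W \<subseteq> V"
      using bR chart_inverse_in[OF ch] by (auto simp: W_def)
    have "\<psi> (g z) \<in> ?b"
      using r chart_in[OF ch V] by (auto simp: open_box_def)
    then have "g z \<in> W"
      using chart_inverse[OF ch V] by (metis W_def imageI)
    moreover have "W \<subseteq> g ` P"
    proof
      fix v assume "v \<in> W"
      then obtain w where "w \<in> Q" "v = \<psi>' (\<psi> (g w))"
        using box by (auto simp: W_def)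
      then show "v \<in> g ` P"
        using chart_inverse[OF ch] gQ QP by auto
    qed
    moreover have "W \<subseteq> manifold_interior n Y"
    proof -
      have "homeomorphic_map (subtopology (Euclidean_space n) R) (subtopology Y V) \<psi>'"
        using ch homeomorphic_map_maps homeomorphic_maps_sym unfolding chart_def by blast
      then have "homeomorphic_map (subtopology (subtopology (Euclidean_space n) R) ?b)
                   (subtopology (subtopology Y V) W) \<psi>'"
        by (rule homeomorphic_map_subtopologies)
           (use bR WV chart_subset[OF ch] in \<open>auto simp: W_def\<close>)
      then have "homeomorphic_map (subtopology (Euclidean_space n) ?b) (subtopology Y W) \<psi>'"
        using bR WV by (simp add: subtopology_subtopology inf_absorb2)
      then have "subtopology (Euclidean_space n) ?b homeomorphic_space subtopology Y W"
        using homeomorphic_map_imp_homeomorphic_space by blast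
      then have "subtopology Y W homeomorphic_space Euclidean_space n"
        using open_box_homeomorphic_Euclidean_space[OF r] homeomorphic_space_sym homeomorphic_space_trans
        by blast
      then show ?thesis
        using W by (auto simp: manifold_interior_def)
    qed
    ultimately show ?thesis
      using W by blast
  qed
  show "openin Y (g ` P)"
  proof (subst openin_subopen, intro ballI)
    fix y assume "y \<in> g ` P"
    then obtain z where "z \<in> P" "y = g z" by (rule imageE)
    with *[of z] show "\<exists>W. openin Y W \<and> y \<in> W \<and> W \<subseteq> g ` P" by blast
  qed
  show "g ` P \<subseteq> manifold_interior n Y"
    using * by blast
qed

text \<open>Topological invariance of the boundary. If a point \<open>v\<close> with \<open>\<psi> v 0 = 0\<close> were interior, the
chart image of its Euclidean neighbourhood would be open in \<open>\<real>\<^sup>n\<close> and so contain points with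
negative first coordinate, outside the half-space.\<close>

lemma half_chart_interior_iff:
  assumes Y: "topological_manifold n Y" and ch: "half_chart n Y V \<psi> \<psi>'" and "n > 0" and v: "v \<in> V"
  shows "v \<in> manifold_interior n Y \<longleftrightarrow> 0 < \<psi> v 0"
proof
  assume "0 < \<psi> v 0"
  let ?P = "{x \<in> topspace (Euclidean_space n). x 0 \<in> {0<..}}"
  have P: "openin (Euclidean_space n) ?P"
    using coordinate_continuous_Euclidean_space[of n UNIV 0]
    by (intro openin_continuous_map_preimage[where Y = euclideanreal]) auto
  have "continuous_map (subtopology (Euclidean_space n) ?P) Y \<psi>'"
    using chart_inverse_continuous[OF ch] by (rule continuous_map_from_subtopology_mono) auto
  moreover have "inj_on \<psi>' ?P"
    by (rule inj_on_inverseI[of _ \<psi>]) (use chart_right_inverse[OF ch] in auto)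
  ultimately have "\<psi>' ` ?P \<subseteq> manifold_interior n Y"
    using invariance_of_domain_manifold(2)[OF Y P] by blast
  moreover have "\<psi> v \<in> ?P"
    using \<open>0 < \<psi> v 0\<close> chart_in[OF ch v] by auto
  ultimately have "\<psi>' (\<psi> v) \<in> manifold_interior n Y"
    by blast
  then show "v \<in> manifold_interior n Y"
    by (simp add: chart_inverse[OF ch v])
next
  assume "v \<in> manifold_interior n Y"
  then obtain U \<theta> \<theta>' where U: "v \<in> U" and ch': "chart n UNIV Y U \<theta> \<theta>'"
    using manifold_interior_chart by metis
  let ?P = "{z \<in> topspace (Euclidean_space n). \<theta>' z \<in> V}"
  have c: "continuous_map (Euclidean_space n) Y \<theta>'"
    using chart_inverse_continuous[OF ch'] by simp
  have P: "openin (Euclidean_space n) ?P"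
    by (rule openin_continuous_map_preimage[OF c chart_open[OF ch]])
  have "inj_on \<theta>' ?P"
    by (rule inj_on_inverseI[of _ \<theta>]) (use chart_right_inverse[OF ch'] in auto)
  then have o: "openin (Euclidean_space n) (\<psi> ` \<theta>' ` ?P)"
    using chart_Euclidean_map[OF ch P] c continuous_map_from_subtopology by blast
  have "\<theta> v \<in> ?P"
    using chart_in[OF ch' U] chart_inverse[OF ch' U] v by auto
  then have "\<psi> (\<theta>' (\<theta> v)) \<in> \<psi> ` \<theta>' ` ?P"
    by (intro imageI)
  then have "\<psi> v \<in> \<psi> ` \<theta>' ` ?P"
    unfolding chart_inverse[OF ch' U] .
  then obtain r where r: "r > 0" "open_box n (\<psi> v) r \<subseteq> \<psi> ` \<theta>' ` ?P"
    by (rule open_box_neighbourhood[OF o])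
  have "0 \<le> \<psi> v 0"
    using chart_in[OF ch v] by auto
  \<comment> \<open>The box stays in the half-space although it reaches below \<open>\<psi> v 0\<close>.\<close>
  let ?w = "(\<psi> v)(0 := \<psi> v 0 - r / 2)"
  have "?w \<in> open_box n (\<psi> v) r"
    using r(1) \<open>n > 0\<close> chart_in[OF ch v] by (auto simp: open_box_def topspace_Euclidean_space)
  with r(2) have "?w \<in> \<psi> ` \<theta>' ` ?P"
    by (rule subsetD)
  then obtain u where u: "u \<in> V" "?w = \<psi> u"
    by blast
  have "0 \<le> \<psi> u 0"
    using chart_in[OF ch u(1)] by simp
  then have "0 \<le> ?w 0"
    unfolding u(2) .
  with r(1) show "0 < \<psi> v 0" by simp
qed

text \<open>In a half-space chart, increasing the first coordinate slightly leads to an interior point.\<close>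

lemma manifold_interior_dense:
  assumes Y: "topological_manifold n Y" and "n > 0" and W: "openin Y W" "W \<noteq> {}"
  shows "W \<inter> manifold_interior n Y \<noteq> {}"
proof -
  obtain y where y: "y \<in> W" using W by blast
  then have "y \<in> topspace Y" using W openin_subset by blast
  from Y this show ?thesis
  proof (cases rule: manifold_chart)
    case (interior V \<psi> \<psi>')
    then have "y \<in> manifold_interior n Y"
      using full_chart_subset_interior by blast
    with y show ?thesis by blast
  next
    case (half V \<psi> \<psi>')
    have "openin Y (W \<inter> V)"
      using W(1) half(2) by (auto simp: chart_def)
    then obtain P where P: "openin (Euclidean_space n) P" "\<psi> ` (W \<inter> V) = P \<inter> {x. 0 \<le> x 0}"
      using chart_image_open[OF half(2)] by (metis inf_le2)
    have "\<psi> y \<in> P" using P(2) y half(1) by blast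
    then obtain r where r: "r > 0" "open_box n (\<psi> y) r \<subseteq> P"
      using open_box_neighbourhood P(1) by blast
    let ?w = "(\<psi> y)(0 := \<psi> y 0 + r / 2)"
    have "?w \<in> open_box n (\<psi> y) r"
      using r(1) \<open>n > 0\<close> chart_in[OF half(2,1)] by (auto simp: open_box_def topspace_Euclidean_space)
    moreover have w0: "0 < ?w 0"
      using r(1) chart_in[OF half(2,1)] by auto
    ultimately have "?w \<in> \<psi> ` (W \<inter> V)"
      using P(2) r(2) by force
    then obtain v where v: "v \<in> W" "v \<in> V" "?w = \<psi> v"
      by blast
    from w0 have "0 < \<psi> v 0"
      unfolding v(3) .
    then have "v \<in> manifold_interior n Y"
      using half_chart_interior_iff[OF Y half(2) \<open>n > 0\<close> v(2)] by simp
    with v show ?thesis by blast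
  qed
qed

text \<open>A separation of \<open>I\<close> into \<open>A\<close> and \<open>B\<close> extends to the whole space: each small neighbourhood meets
\<open>I\<close> inside \<open>A\<close> or inside \<open>B\<close>, and by density neighbourhoods of different kinds are disjoint.\<close>

lemma connectedin_dense_subset:
  assumes Y: "connected_space Y" and I: "I \<subseteq> topspace Y"
    and dense: "\<And>W. openin Y W \<Longrightarrow> W \<noteq> {} \<Longrightarrow> W \<inter> I \<noteq> {}"
    and loc: "\<And>y. y \<in> topspace Y \<Longrightarrow> \<exists>V. openin Y V \<and> y \<in> V \<and> connectedin Y (V \<inter> I)"
  shows "connectedin Y I"
  unfolding connectedin
proof (intro conjI I notI, elim exE conjE)
  fix A B
  assume A: "openin Y A" and B: "openin Y B" and AB: "I \<subseteq> A \<union> B" "A \<inter> B \<inter> I = {}"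
    and ne: "A \<inter> I \<noteq> {}" "B \<inter> I \<noteq> {}"
  define fill where "fill S = \<Union>{V. openin Y V \<and> V \<inter> I \<subseteq> S}" for S
  have "openin Y (fill A)" "openin Y (fill B)"
    unfolding fill_def by auto
  moreover have "topspace Y \<subseteq> fill A \<union> fill B"
  proof
    fix y assume "y \<in> topspace Y"
    then obtain V where V: "openin Y V" "y \<in> V" "connectedin Y (V \<inter> I)"
      using loc by blast
    have "A \<inter> (V \<inter> I) = {} \<or> B \<inter> (V \<inter> I) = {}"
      using V(3) A B AB unfolding connectedin by blast
    then have "V \<inter> I \<subseteq> A \<or> V \<inter> I \<subseteq> B"
      using AB by blast
    with V show "y \<in> fill A \<union> fill B"
      unfolding fill_def by blast
  qed
  moreover have "fill A \<inter> fill B = {}"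
  proof (rule ccontr)
    assume "fill A \<inter> fill B \<noteq> {}"
    then obtain U V where "openin Y U" "U \<inter> I \<subseteq> A" "openin Y V" "V \<inter> I \<subseteq> B" "U \<inter> V \<noteq> {}"
      unfolding fill_def by blast
    moreover from this have "U \<inter> V \<inter> I \<noteq> {}"
      using dense by blast
    ultimately show False
      using AB by blast
  qed
  moreover have "A \<subseteq> fill A" "B \<subseteq> fill B"
    unfolding fill_def using A B by blast+
  then have "fill A \<noteq> {}" "fill B \<noteq> {}"
    using ne by blast+
  ultimately show False
    using Y unfolding connected_space_def by blast
qed

text \<open>Each chart meets the interior in a copy of \<open>\<real>\<^sup>n\<close> or of the open half-space, which is convex.\<close>

lemma connectedin_manifold_interior:
  assumes Y: "topological_manifold n Y" and "n > 0" and "connected_space Y"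
  shows "connectedin Y (manifold_interior n Y)"
proof (rule connectedin_dense_subset[OF assms(3)])
  show "manifold_interior n Y \<subseteq> topspace Y"
    by (rule openin_subset[OF openin_manifold_interior])
  show "W \<inter> manifold_interior n Y \<noteq> {}" if "openin Y W" "W \<noteq> {}" for W
    using manifold_interior_dense[OF Y \<open>n > 0\<close> that] .
  have img: "connectedin Y (\<psi>' ` C)" if ch: "chart n R Y V \<psi> \<psi>'"
    and C: "connectedin (Euclidean_space n) C" "C \<subseteq> R" for R V \<psi> \<psi>' C
    by (rule connectedin_continuous_map_image[OF chart_inverse_continuous[OF ch]])
       (use C in \<open>simp add: connectedin_subtopology\<close>)
  fix y assume "y \<in> topspace Y"
  with Y show "\<exists>V. openin Y V \<and> y \<in> V \<and> connectedin Y (V \<inter> manifold_interior n Y)"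
  proof (cases rule: manifold_chart)
    case (interior V \<psi> \<psi>')
    have "connectedin (Euclidean_space n) (topspace (Euclidean_space n))"
      by (rule connectedin_Euclidean_space_convex) (auto simp: topspace_Euclidean_space)
    then have "connectedin Y (\<psi>' ` topspace (Euclidean_space n))"
      using img[OF interior(2)] by blast
    moreover have "V \<subseteq> manifold_interior n Y"
      using full_chart_subset_interior interior(2) by blast
    moreover have "V = \<psi>' ` topspace (Euclidean_space n)"
      using chart_in[OF interior(2)] chart_inverse[OF interior(2)] chart_inverse_in[OF interior(2)]
      by (force simp: image_iff)
    ultimately show ?thesis
      using interior by (metis chart_def inf_absorb1)
  next
    case (half V \<psi> \<psi>')
    let ?C = "{x \<in> topspace (Euclidean_space n). 0 < x 0}"
    have "connectedin (Euclidean_space n) ?C"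
      by (rule connectedin_Euclidean_space_convex)
         (auto simp: topspace_Euclidean_space intro: convex_combination_bounds(3))
    then have "connectedin Y (\<psi>' ` ?C)"
      using img[OF half(2)] by force
    moreover have "\<psi>' ` ?C = V \<inter> manifold_interior n Y"
    proof (intro equalityI subsetI)
      fix v assume "v \<in> \<psi>' ` ?C"
      then obtain w where w: "w \<in> ?C" "v = \<psi>' w" by blast
      then have "v \<in> V" "\<psi> v = w"
        using chart_inverse_in[OF half(2)] chart_right_inverse[OF half(2)] by auto
      then show "v \<in> V \<inter> manifold_interior n Y"
        using half_chart_interior_iff[OF Y half(2) \<open>n > 0\<close>] w by auto
    next
      fix v assume "v \<in> V \<inter> manifold_interior n Y"
      then have v: "v \<in> V" and "\<psi> v \<in> ?C"
        using half_chart_interior_iff[OF Y half(2) \<open>n > 0\<close>] chart_in[OF half(2)] by auto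
      show "v \<in> \<psi>' ` ?C"
        by (rule image_eqI[of v \<psi>' "\<psi> v"]) (simp add: chart_inverse[OF half(2) v], fact)
    qed
    ultimately show ?thesis
      using half unfolding chart_def by auto
  qed
qed

section \<open>From an immersion of the interior to a homeomorphism\<close>

text \<open>In dimension 0 the half-space is the whole one-point space, so every chart is a full chart.\<close>

lemma manifold_boundary_dimension_pos:
  assumes Y: "topological_manifold n Y" and "manifold_boundary n Y \<noteq> {}"
  shows "n > 0"
proof (rule ccontr)
  assume "\<not> 0 < n"
  then have E: "topspace (Euclidean_space n) \<subseteq> {x. 0 \<le> x 0}"
    by (auto simp: topspace_Euclidean_space)
  obtain y where y: "y \<in> topspace Y" "y \<notin> manifold_interior n Y"
    using assms(2) unfolding manifold_boundary_def by blast
  from Y y(1) show False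
  proof (cases rule: manifold_chart)
    case (interior V \<psi> \<psi>')
    then show False
      using full_chart_subset_interior y(2) by blast
  next
    case (half V \<psi> \<psi>')
    then have "chart n UNIV Y V \<psi> \<psi>'"
      by (simp add: chart_def subtopology_superset[OF E])
    then show False
      using full_chart_subset_interior half(1) y(2) by blast
  qed
qed

lemma boundary_half_chart:
  assumes Y: "topological_manifold n Y" and y: "y \<in> manifold_boundary n Y"
  obtains V \<psi> \<psi>' where "y \<in> V" "half_chart n Y V \<psi> \<psi>'"
proof -
  have "y \<in> topspace Y" "y \<notin> manifold_interior n Y"
    using y by (auto simp: manifold_boundary_def)
  from Y this(1) show thesis
  proof (cases rule: manifold_chart)
    case (interior V \<psi> \<psi>')
    then show thesis
      using full_chart_subset_interior \<open>y \<notin> manifold_interior n Y\<close> by blast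
  qed (rule that)
qed

text \<open>An immersion is only required to be a local homeomorphism onto its image; equality of dimensions
makes that image open, by invariance of domain.\<close>

lemma interior_immersion_locally_homeomorphic:
  assumes Y: "topological_manifold n Y"
    and imm: "immersion_map (subtopology X (manifold_interior n X)) Y f"
    and x: "x \<in> manifold_interior n X"
  obtains U where "openin X U" "x \<in> U" "inj_on f U" "open_map (subtopology X U) Y f"
    "f ` U \<subseteq> manifold_interior n Y"
proof -
  let ?I = "manifold_interior n X"
  have I: "openin X ?I" by (rule openin_manifold_interior)
  have cont: "continuous_map (subtopology X ?I) Y f"
    using imm by (simp add: immersion_map_def)
  have "x \<in> topspace (subtopology X ?I)"
    using x openin_subset[OF I] by auto
  then obtain U1 where U1: "openin (subtopology X ?I) U1" "x \<in> U1"
    "homeomorphic_map (subtopology (subtopology X ?I) U1) (subtopology Y (f ` U1)) f"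
    using imm unfolding immersion_map_def by blast
  have oU1: "openin X U1" "U1 \<subseteq> ?I"
    using U1(1) I by (auto simp: openin_open_subtopology)
  have "inj_on f (topspace (subtopology (subtopology X ?I) U1))"
    by (rule homeomorphic_imp_injective_map[OF U1(3)])
  moreover have "topspace (subtopology (subtopology X ?I) U1) = U1"
    using oU1 openin_subset by fastforce
  ultimately have injU1: "inj_on f U1" by simp
  obtain V \<theta> \<theta>' where V: "x \<in> V" and ch: "chart n UNIV X V \<theta> \<theta>'"
    by (rule manifold_interior_chart[OF x])
  let ?U = "U1 \<inter> V"
  have oU: "openin X ?U"
    using oU1(1) chart_open[OF ch] by blast
  have key: "openin Y (f ` S) \<and> f ` S \<subseteq> manifold_interior n Y" if S: "openin X S" "S \<subseteq> ?U" for S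
  proof -
    have SV: "S \<subseteq> V" using S(2) by blast
    obtain P where P: "openin (Euclidean_space n) P" "\<theta> ` S = P \<inter> UNIV"
      by (rule chart_image_open[OF ch S(1) SV])
    have P_eq: "\<theta> ` S = P" using P(2) by simp
    have restore: "\<theta>' ` P = S"
    proof -
      have "\<theta>' ` \<theta> ` S = (\<lambda>v. v) ` S"
        unfolding image_image by (rule image_cong) (use chart_inverse[OF ch] SV in auto)
      then show ?thesis using P_eq by simp
    qed
    have "continuous_map (subtopology (Euclidean_space n) P) X \<theta>'"
      using chart_inverse_continuous[OF ch] continuous_map_from_subtopology by (metis subtopology_UNIV)
    moreover have "\<theta>' ` P \<subseteq> ?I"
      using restore S(2) oU1(2) by blast
    ultimately have "continuous_map (subtopology (Euclidean_space n) P) (subtopology X ?I) \<theta>'"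
      by (auto simp: continuous_map_in_subtopology)
    then have "continuous_map (subtopology (Euclidean_space n) P) Y (f \<circ> \<theta>')"
      using cont by (rule continuous_map_compose)
    moreover have "inj_on (f \<circ> \<theta>') P"
    proof (rule comp_inj_on)
      show "inj_on \<theta>' P"
        by (rule inj_on_inverseI[of _ \<theta>])
           (use chart_right_inverse[OF ch] openin_subset[OF P(1)] in auto)
      show "inj_on f (\<theta>' ` P)"
        unfolding restore by (rule inj_on_subset[OF injU1]) (use S(2) in blast)
    qed
    ultimately have "openin Y ((f \<circ> \<theta>') ` P)" "(f \<circ> \<theta>') ` P \<subseteq> manifold_interior n Y"
      using invariance_of_domain_manifold[OF Y P(1)] by blast+
    moreover have "(f \<circ> \<theta>') ` P = f ` S"
      by (simp only: image_comp[symmetric] restore)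
    ultimately show ?thesis by simp
  qed
  show thesis
  proof (rule that[of ?U])
    show "inj_on f ?U"
      by (rule inj_on_subset[OF injU1]) blast
    show "open_map (subtopology X ?U) Y f"
      using key oU by (auto simp: open_map_def openin_open_subtopology)
    show "f ` ?U \<subseteq> manifold_interior n Y"
      using key[OF oU] by blast
  qed (use oU U1(2) V in auto)
qed

text \<open>The one-sheet argument. Close to \<open>f p\<close> all preimages lie in a chart half-box \<open>N\<close> around \<open>p\<close>,
small enough that \<open>f\<close> maps it into a single half-space chart \<open>V\<close> of \<open>Y\<close>. Two preimages \<open>e1\<close>,
\<open>e2\<close> of one interior point are joined by a segment in \<open>N\<close>, which is also the lift of its own image, a
loop in a simply connected box. The loop lifts to a loop, so \<open>e1 = e2\<close>.\<close>

lemma injective_near_boundary_point: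
  assumes X: "topological_manifold n X" and Y: "topological_manifold n Y"
    and loc: "compact_local_homeomorphism X Y f (manifold_interior n Y)"
    and int: "\<And>x. x \<in> topspace X \<Longrightarrow> f x \<in> manifold_interior n Y \<longleftrightarrow> x \<in> manifold_interior n X"
    and p: "p \<in> manifold_boundary n X"
    and fibre: "\<And>e. e \<in> topspace X \<Longrightarrow> f e = f p \<Longrightarrow> e = p"
  obtains W where "openin Y W" "f p \<in> W"
    "inj_on f {x \<in> topspace X. f x \<in> W \<inter> manifold_interior n Y}"
proof -
  interpret compact_local_homeomorphism X Y f "manifold_interior n Y" by (rule loc)
  have n: "n > 0"
    using manifold_boundary_dimension_pos[OF X] p by blast
  have pX: "p \<in> topspace X" and "p \<notin> manifold_interior n X"
    using p by (auto simp: manifold_boundary_def)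
  moreover have fpY: "f p \<in> topspace Y"
    using continuous pX by (auto simp: continuous_map_def)
  ultimately have "f p \<in> manifold_boundary n Y"
    using int by (auto simp: manifold_boundary_def)
  then obtain V \<psi> \<psi>' where V: "f p \<in> V" and ch: "half_chart n Y V \<psi> \<psi>'"
    by (rule boundary_half_chart[OF Y])
  obtain U \<phi> \<phi>' where U: "p \<in> U" and ch': "half_chart n X U \<phi> \<phi>'"
    by (rule boundary_half_chart[OF X p])
  define U1 where "U1 = U \<inter> {x \<in> topspace X. f x \<in> V}"
  have oU1: "openin X U1"
    unfolding U1_def
    by (intro openin_Int chart_open[OF ch'] openin_continuous_map_preimage[OF continuous] chart_open[OF ch])
  have U1U: "U1 \<subseteq> U" by (auto simp: U1_def)
  have pU1: "p \<in> U1" using U V pX by (auto simp: U1_def)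
  obtain P where P: "openin (Euclidean_space n) P" "\<phi> ` U1 = P \<inter> {x. 0 \<le> x 0}"
    by (rule chart_image_open[OF ch' oU1 U1U])
  have "\<phi> p \<in> P" using P(2) pU1 by blast
  then obtain r where r: "r > 0" "open_box n (\<phi> p) r \<subseteq> P"
    by (rule open_box_neighbourhood[OF P(1)])
  let ?b = "open_box n (\<phi> p) r"
  define N where "N = \<phi>' ` (?b \<inter> {x. 0 \<le> x 0})"
  have oN: "openin X N"
    unfolding N_def by (rule chart_preimage_open[OF ch' openin_open_box])
  have \<phi>'b: "\<phi>' w \<in> U1 \<and> \<phi> (\<phi>' w) = w" if w: "w \<in> ?b" "0 \<le> w 0" for w
  proof -
    have "w \<in> \<phi> ` U1" using P(2) r(2) w by blast
    then obtain u where "u \<in> U1" "w = \<phi> u" by blast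
    then show ?thesis using chart_inverse[OF ch'] U1U by auto
  qed
  have \<phi>N: "x \<in> U1 \<and> \<phi> x \<in> ?b" if "x \<in> N" for x
    using that \<phi>'b unfolding N_def by auto
  have "\<phi> p \<in> ?b \<inter> {x. 0 \<le> x 0}"
    using chart_in[OF ch' U] r(1) by (auto simp: open_box_def)
  then have "\<phi>' (\<phi> p) \<in> N"
    unfolding N_def by (rule imageI)
  then have pN: "p \<in> N"
    by (simp add: chart_inverse[OF ch' U])
  \<comment> \<open>Over \<open>W\<close> every preimage lies in \<open>N\<close>.\<close>
  define W where "W = topspace Y - f ` (topspace X - N)"
  have oW: "openin Y W"
    unfolding W_def using closed_image[of "topspace X - N"] oN by blast
  have "f p \<notin> f ` (topspace X - N)"
  proof
    assume "f p \<in> f ` (topspace X - N)"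
    then obtain e where e: "e \<in> topspace X" "e \<notin> N" "f p = f e" by blast
    then have "e = p" by (intro fibre) auto
    with e(2) pN show False by simp
  qed
  then have fpW: "f p \<in> W"
    unfolding W_def using fpY by simp
  have "e1 = e2"
    if e: "e1 \<in> topspace X" "e2 \<in> topspace X" "f e1 = f e2" "f e1 \<in> W" "f e1 \<in> manifold_interior n Y"
    for e1 e2
  proof -
    have eN: "e1 \<in> N" "e2 \<in> N"
      using e unfolding W_def by blast+
    have eI: "e1 \<in> manifold_interior n X" "e2 \<in> manifold_interior n X"
      using e int[of e1] int[of e2] by simp_all
    have eU: "e1 \<in> U" "e2 \<in> U" and eb: "\<phi> e1 \<in> ?b" "\<phi> e2 \<in> ?b"
      using \<phi>N eN U1U by auto
    have pos: "0 < \<phi> e1 0" "0 < \<phi> e2 0"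
      using half_chart_interior_iff[OF X ch' n] eU eI by auto
    define \<gamma> where "\<gamma> = (\<lambda>t i. (1 - t) * \<phi> e1 i + t * \<phi> e2 i)"
    have \<gamma>01: "\<gamma> 0 = \<phi> e1" "\<gamma> 1 = \<phi> e2"
      by (auto simp: \<gamma>_def)
    have \<gamma>b: "\<gamma> t \<in> ?b" "0 < \<gamma> t 0" if t: "0 \<le> t" "t \<le> 1" for t
    proof -
      have "\<gamma> t \<in> topspace (Euclidean_space n)"
        using eb by (auto simp: open_box_def topspace_Euclidean_space \<gamma>_def)
      moreover have "\<bar>\<gamma> t i - \<phi> p i\<bar> < r" if i: "i < n" for i
      proof -
        have "\<phi> p i - r < \<phi> e1 i" "\<phi> e1 i < \<phi> p i + r" "\<phi> p i - r < \<phi> e2 i" "\<phi> e2 i < \<phi> p i + r"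
          using eb i by (auto simp: open_box_def abs_less_iff dest!: spec[of _ i])
        then have "\<phi> p i - r < \<gamma> t i" "\<gamma> t i < \<phi> p i + r"
          unfolding \<gamma>_def using convex_combination_bounds(3,4)[OF t] by blast+
        then show ?thesis by (simp add: abs_less_iff)
      qed
      ultimately show "\<gamma> t \<in> ?b"
        by (simp add: open_box_def)
      show "0 < \<gamma> t 0"
        unfolding \<gamma>_def using convex_combination_bounds(3)[OF t] pos by blast
    qed
    let ?T = "top_of_set {0..1::real}"
    define g where "g = \<phi>' \<circ> \<gamma>"
    have "continuous_map ?T (Euclidean_space n) \<gamma>"
      unfolding \<gamma>_def
      by (intro continuous_map_from_subtopology segment_continuous_Euclidean_space)
         (use chart_in[OF ch'] eU in auto)
    then have "continuous_map ?T (subtopology (Euclidean_space n) {x. 0 \<le> x 0}) \<gamma>"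
      using \<gamma>b(2) by (force simp: continuous_map_in_subtopology)
    then have cg: "continuous_map ?T X g"
      unfolding g_def using chart_inverse_continuous[OF ch'] by (rule continuous_map_compose)
    have gt: "g t \<in> U1" "\<phi> (g t) = \<gamma> t" if "0 \<le> t" "t \<le> 1" for t
      using \<phi>'b[OF \<gamma>b(1)[OF that]] \<gamma>b(2)[OF that] by (auto simp: g_def)
    have fgV: "f (g t) \<in> V" if "0 \<le> t" "t \<le> 1" for t
      using gt(1)[OF that] by (auto simp: U1_def)
    have fgI: "f (g t) \<in> manifold_interior n Y" if t: "0 \<le> t" "t \<le> 1" for t
    proof -
      have "g t \<in> U" "g t \<in> topspace X"
        using gt(1)[OF t] by (auto simp: U1_def)
      then show ?thesis
        using half_chart_interior_iff[OF X ch' n] gt(2)[OF t] \<gamma>b(2)[OF t] int by auto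
    qed
    \<comment> \<open>The image loop \<open>h\<close>, read in the chart of \<open>Y\<close>; its coordinatewise minima and maxima bound the box \<open>B\<close>.\<close>
    define h where "h = \<psi> \<circ> (f \<circ> g)"
    have "continuous_map ?T Y (f \<circ> g)"
      using cg continuous by (rule continuous_map_compose)
    then have "continuous_map ?T (subtopology Y V) (f \<circ> g)"
      using fgV by (auto simp: continuous_map_in_subtopology)
    then have ch_cont: "continuous_map ?T (Euclidean_space n) h"
      unfolding h_def using chart_continuous[OF ch] by (rule continuous_map_compose)
    have hpos: "0 < h t 0" if t: "0 \<le> t" "t \<le> 1" for t
      using half_chart_interior_iff[OF Y ch n fgV[OF t]] fgI[OF t] by (simp add: h_def)
    have "continuous_map ?T euclideanreal ((\<lambda>x. x i) \<circ> h)" for i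
      using ch_cont coordinate_continuous_Euclidean_space[of n UNIV i]
      by (intro continuous_map_compose) auto
    then have hi: "continuous_on {0..1} (\<lambda>t. h t i)" for i
      by (simp add: o_def)
    have "\<exists>m\<in>{0..1}. \<forall>t\<in>{0..1}. h m i \<le> h t i" for i
      using continuous_attains_inf[OF compact_Icc _ hi] by auto
    then obtain m where m: "\<And>i. m i \<in> {0..1}" "\<And>i t. t \<in> {0..1} \<Longrightarrow> h (m i) i \<le> h t i"
      by metis
    have "\<exists>M\<in>{0..1}. \<forall>t\<in>{0..1}. h t i \<le> h M i" for i
      using continuous_attains_sup[OF compact_Icc _ hi] by auto
    then obtain M where M: "\<And>i t. t \<in> {0..1} \<Longrightarrow> h t i \<le> h (M i) i"
      by metis
    define B where "B = {z \<in> topspace (Euclidean_space n). \<forall>i<n. h (m i) i \<le> z i \<and> z i \<le> h (M i) i}"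
    have hE: "h t \<in> topspace (Euclidean_space n)" if "t \<in> {0..1}" for t
      using ch_cont that by (auto simp: continuous_map_def)
    have hB: "h t \<in> B" if "t \<in> {0..1}" for t
      using hE[OF that] m(2)[OF that] M[OF that] by (simp add: B_def)
    \<comment> \<open>The minimum of the first coordinate is attained on the loop, hence positive.\<close>
    have Bpos: "0 < z 0" if "z \<in> B" for z
    proof -
      have "h (m 0) 0 \<le> z 0" using that n by (simp add: B_def)
      moreover have "0 < h (m 0) 0" using hpos m(1)[of 0] by simp
      ultimately show ?thesis by linarith
    qed
    have BE: "B \<subseteq> topspace (Euclidean_space n)"
      by (auto simp: B_def)
    have "B \<subseteq> {x. 0 \<le> x 0}"
      using Bpos less_imp_le by blast
    then have c\<psi>': "continuous_map (subtopology (Euclidean_space n) B) Y \<psi>'"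
      by (rule continuous_map_from_subtopology_mono[OF chart_inverse_continuous[OF ch]])
    have B\<psi>: "\<psi>' z \<in> V \<and> \<psi> (\<psi>' z) = z" if z: "z \<in> B" for z
    proof -
      have "z \<in> topspace (Euclidean_space n) \<inter> {x. 0 \<le> x 0}"
        using Bpos[OF z] z BE by auto
      then show ?thesis
        using chart_inverse_in[OF ch] chart_right_inverse[OF ch] by blast
    qed
    have "\<psi>' ` B \<subseteq> manifold_interior n Y"
      using half_chart_interior_iff[OF Y ch n] B\<psi> Bpos by auto
    then have lift: "liftable (subtopology (Euclidean_space n) B) \<psi>' B"
      using liftable_box[of n "\<lambda>i. h (m i) i" "\<lambda>i. h (M i) i" \<psi>'] c\<psi>' unfolding B_def by blast
    have \<psi>'h: "\<psi>' (h t) = f (g t)" if "0 \<le> t" "t \<le> 1" for t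
      using chart_inverse[OF ch fgV[OF that]] by (simp add: h_def)
    have g01: "g 0 = e1" "g 1 = e2"
      using chart_inverse[OF ch'] eU by (simp_all add: g_def \<gamma>01)
    have h01: "h 1 = h 0"
      using e(3) g01 by (simp add: h_def)
    have "f e1 = \<psi>' (h 0)"
      using \<psi>'h[of 0] g01 by simp
    then obtain s where s: "continuous_map (subtopology (subtopology (Euclidean_space n) B) B) X s"
      "\<forall>w\<in>B. f (s w) = \<psi>' w" "s (h 0) = e1"
      using lift hB[of 0] e(1) unfolding liftable_def by force
    \<comment> \<open>Both the segment \<open>g\<close> and \<open>s \<circ> h\<close> lift the loop from \<open>e1\<close>; the second one is closed.\<close>
    have "g 1 = (s \<circ> h) 1"
    proof (rule lifts_agree[where Z = ?T and X = X and f = f and a = 0])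
      show "connected_space ?T"
        using connected_Icc by (simp add: connected_space_subtopology)
      have "continuous_map ?T (subtopology (subtopology (Euclidean_space n) B) B) h"
        using ch_cont hB by (auto simp: continuous_map_in_subtopology)
      then show "continuous_map ?T X (s \<circ> h)"
        using s(1) by (rule continuous_map_compose)
      fix t assume "t \<in> topspace ?T"
      then have t: "0 \<le> t" "t \<le> 1" by auto
      show "f (g t) = f ((s \<circ> h) t)"
        using s(2) hB[of t] \<psi>'h[OF t] t by simp
      have "g t \<in> topspace X"
        using gt(1)[OF t] by (simp add: U1_def)
      then show "\<exists>U. openin X U \<and> g t \<in> U \<and> inj_on f U"
        using locally_homeomorphic fgI[OF t] by blast
    qed (use Hausdorff_X cg s(3) g01 in auto)
    then show "e1 = e2"
      using s(3) g01 h01 by simp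
  qed
  then have "inj_on f {x \<in> topspace X. f x \<in> W \<inter> manifold_interior n Y}"
    by (auto simp: inj_on_def)
  with oW fpW show thesis by (rule that)
qed

theorem theorem1p3:
  fixes X :: "'a topology" and Y :: "'b topology" and n :: nat and f :: "'a \<Rightarrow> 'b"
  assumes "topological_manifold n X" and "topological_manifold n Y"
    and "connected_space X" and "connected_space Y"
    and "manifold_boundary n X \<noteq> {}" and "manifold_boundary n Y \<noteq> {}"
    and "compact_space X"
    and "continuous_map X Y f"
    and "f ` manifold_boundary n X \<subseteq> manifold_boundary n Y"
    and "inj_on f (manifold_boundary n X)"
    and "immersion_map (subtopology X (topspace X - manifold_boundary n X)) Y f"
  shows "homeomorphic_map X Y f"
proof -
  note X = assms(1) and Y = assms(2)
  let ?IX = "manifold_interior n X" and ?IY = "manifold_interior n Y"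
  have n: "n > 0"
    using manifold_boundary_dimension_pos[OF X] assms(5) by blast
  have IX: "?IX \<subseteq> topspace X" and IY: "?IY \<subseteq> topspace Y"
    by (rule openin_subset[OF openin_manifold_interior])+
  have "topspace X - manifold_boundary n X = ?IX"
    using IX by (auto simp: manifold_boundary_def)
  then have imm: "immersion_map (subtopology X ?IX) Y f"
    using assms(11) by simp
  have int: "f x \<in> ?IY \<longleftrightarrow> x \<in> ?IX" if x: "x \<in> topspace X" for x
  proof
    show "f x \<in> ?IY" if xI: "x \<in> ?IX"
    proof -
      obtain U where "x \<in> U" "f ` U \<subseteq> ?IY"
        by (rule interior_immersion_locally_homeomorphic[OF Y imm xI])
      then show ?thesis by blast
    qed
    show "x \<in> ?IX" if "f x \<in> ?IY"
      using assms(9) that x unfolding manifold_boundary_def by blast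
  qed
  have loc: "compact_local_homeomorphism X Y f ?IY"
  proof
    show "Hausdorff_space X" "Hausdorff_space Y"
      using X Y by (auto simp: topological_manifold_def)
    fix x assume "x \<in> topspace X" "f x \<in> ?IY"
    then have xI: "x \<in> ?IX" using int by blast
    obtain U where "openin X U" "x \<in> U" "inj_on f U" "open_map (subtopology X U) Y f"
      by (rule interior_immersion_locally_homeomorphic[OF Y imm xI])
    then show "\<exists>U. openin X U \<and> x \<in> U \<and> inj_on f U \<and> open_map (subtopology X U) Y f"
      by blast
  qed (use assms in auto)
  then interpret compact_local_homeomorphism X Y f ?IY .
  have conn: "connectedin Y ?IY"
    by (rule connectedin_manifold_interior[OF Y n assms(4)])
  have "topspace X \<noteq> {}"
    using assms(5) by (auto simp: manifold_boundary_def)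
  then obtain x where "x \<in> ?IX"
    using manifold_interior_dense[OF X n openin_topspace] by blast
  then have IY_image: "?IY \<subseteq> f ` topspace X"
    using image_contains_connected[OF conn] int IX by blast
  have onto: "f ` topspace X = topspace Y"
  proof
    show "f ` topspace X \<subseteq> topspace Y"
      using continuous by (auto simp: continuous_map_def)
    have "openin Y (topspace Y - f ` topspace X)"
      using closed_image[OF closedin_topspace] by blast
    then show "topspace Y \<subseteq> f ` topspace X"
      using manifold_interior_dense[OF Y n] IY_image by blast
  qed
  obtain p where p: "p \<in> manifold_boundary n X"
    using assms(5) by blast
  have fibre: "e = p" if e: "e \<in> topspace X" "f e = f p" for e
  proof -
    have "e \<notin> ?IX"
      using int[OF e(1)] int[of p] e(2) p by (auto simp: manifold_boundary_def)
    then have "e \<in> manifold_boundary n X"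
      using e(1) by (simp add: manifold_boundary_def)
    then show ?thesis
      using assms(10) p e(2) by (auto dest: inj_onD)
  qed
  obtain W where W: "openin Y W" "f p \<in> W" "inj_on f {x \<in> topspace X. f x \<in> W \<inter> ?IY}"
    by (rule injective_near_boundary_point[OF X Y loc int p fibre])
  have "W \<inter> ?IY \<noteq> {}"
    using manifold_interior_dense[OF Y n W(1)] W(2) by blast
  then have inj_int: "inj_on f {x \<in> topspace X. f x \<in> ?IY}"
    using W by (intro injective_over_connected[OF conn, of "W \<inter> ?IY"])
      (auto simp: openin_manifold_interior)
  have "inj_on f (topspace X)"
  proof (rule inj_onI)
    fix x y assume xy: "x \<in> topspace X" "y \<in> topspace X" "f x = f y"
    show "x = y"
    proof (cases "f x \<in> ?IY")
      case True
      then show ?thesis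
        using inj_onD[OF inj_int xy(3)] xy by auto
    next
      case False
      then have "x \<in> manifold_boundary n X" "y \<in> manifold_boundary n X"
        using xy int[of x] int[of y] by (auto simp: manifold_boundary_def)
      then show ?thesis
        using inj_onD[OF assms(10) xy(3)] by blast
    qed
  qed
  then show ?thesis
    using onto by (intro continuous_imp_homeomorphic_map continuous compact Hausdorff_Y)
qed

end
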